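(* (Weak coupling.) Let $\theta\in[0,\infty)$ and let $(u_+(z),u_-(z))_{z\ge0}$ be the $\mathbb C^2$-valued Markov process with initial condition $u_\pm(0)=a_e^{(0)}\pm a_o^{(0)}$, $(a_e^{(0)},a_o^{(0)})\ne(0,0)$, and infinitesimal generator $\mathcal L_{u_+}+\mathcal L_{u_-}+\theta\mathcal L_{u_+,u_-}$, where $$\begin{aligned}\mathcal L_u=&\ \Gamma\big(2|u|^2\partial_u\partial_{\overline u}-u^2\partial_u^2-\overline u^2\partial_{\overline u}^2-u\partial_u-\overline u\partial_{\overline u}\big)-\frac{\Lambda+i\Theta}2u\partial_u-\frac{\Lambda-i\Theta}2\overline u\partial_{\overline u}+i(\kappa+\kappa^{\rm ev})(u\partial_u-\overline u\partial_{\overline u}),\\ \mathcal L_{u_+,u_-}=&\ i\beta'\big(u_+\partial_{u_-}+u_-\partial_{u_+}-\overline{u_+}\partial_{\overline{u_-}}-\overline{u_-}\partial_{\overline{u_+}}\big).\end{aligned}$$ Let $\mathcal P(z)=\dfrac{|u_+(z)|^2-|u_-(z)|^2}{|u_+(z)|^2+|u_-(z)|^2}$. Then: (i) with probability one, $|u_+(z)|^2+|u_-(z)|^2=2\big(|a_e^{(0)}|^2+|a_o^{(0)}|^2\big)e^{-\Lambda z}$; (ii) $\mathbb E[\mathcal P(z)]$ satisfies the damped harmonic oscillator equation $$\big[\partial_z^2+2\Gamma\partial_z+(2\theta\beta')^2\big]\mathbb E[\mathcal P(z)]=0;$$ (iii) if $a_e^{(0)}=a_o^{(0)}$ (so that $u_-(0)=0$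 and $\mathcal P(0)=1$), then $$\mathbb E[\mathcal P(z)]=\begin{cases}e^{-\Gamma z}\Big[\cosh\big(\sqrt{\Gamma^2-(2\theta\beta')^2}\,z\big)+\dfrac{\Gamma}{\sqrt{\Gamma^2-(2\theta\beta')^2}}\sinh\big(\sqrt{\Gamma^2-(2\theta\beta')^2}\,z\big)\Big]&\text{if }2\theta\beta'<\Gamma,\\[2mm](1+\Gamma z)e^{-\Gamma z}&\text{if }2\theta\beta'=\Gamma,\\[2mm]e^{-\Gamma z}\Big[\cos\big(\sqrt{(2\theta\beta')^2-\Gamma^2}\,z\big)+\dfrac{\Gamma}{\sqrt{(2\theta\beta')^2-\Gamma^2}}\sin\big(\sqrt{(2\theta\beta')^2-\Gamma^2}\,z\big)\Big]&\text{if }2\theta\beta'>\Gamma.\end{cases}$$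
   Context: Complex derivatives: for $\zeta=\zeta_r+i\zeta_i$, $\partial_\zeta=\frac12(\partial_{\zeta_r}-i\partial_{\zeta_i})$, $\partial_{\overline\zeta}=\frac12(\partial_{\zeta_r}+i\partial_{\zeta_i})$; the generator acts on functions of $(u_+,\overline{u_+},u_-,\overline{u_-})$. The process is the $\varepsilon\to0$ limit of the amplitudes of the waves guided by two randomly perturbed single-mode step-index waveguides (width $D$, index of refraction $n>1$, separation $d$ with $\theta=\varepsilon^{-2}e^{-\eta d}$ independent of $\varepsilon$) at wavenumber $k$, with $kD\sqrt{n^2-1}<\pi$. Here $\beta$ is the unique solution in $(k,nk)$ of $\frac{\sqrt{n^2k^2-\beta^2}}{\sqrt{\beta^2-k^2}}\tan(\frac D2\sqrt{n^2k^2-\beta^2})=1$, $\xi=\sqrt{n^2k^2-\beta^2}$, $\eta=\sqrt{\beta^2-k^2}$, and $\beta'=\eta\big/\big[\beta(1+\frac{\eta^2}{\xi^2})(\frac1\eta+\frac D2)\big]$. The real coefficients ($\Gamma,\Lambda\ge0$) are as follows. Let $\mathcal R$ be the smooth, integrable covariance function of the stationary interface fluctuations and $\widehat{\mathcal R}(\kappa)=\int_{-\infty}^\infty\mathcal R(z)e^{i\kappa z}dz\ge0$; $\xi_\gamma=\sqrt{k^2n^2-\gamma}$, $\eta_\gamma=\sqrt{k^2-\gamma}$, $G(\gamma)=\dfrac{2\frac{\xi_\gamma^2}{\eta_\gamma^2}+\sin^2(\xi_\gamma D)(1-\frac{\xi_\gamma^2}{\eta_\gamma^2})}{4\frac{\xi_\gamma^2}{\eta_\gamma^2}+\sin^2(\xi_\gamma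 D)(1-\frac{\xi_\gamma^2}{\eta_\gamma^2})^2}$, $M=\dfrac{k^4(n^2-1)^2D^2}{\beta(\frac2\eta+D)}\cos^2(\frac{\xi D}2)$. Then $$\Gamma=\frac{k^4(n^2-1)^2D^2}{\beta^2(\frac2\eta+D)^2}\cos^4\Big(\frac{\xi D}2\Big)\widehat{\mathcal R}(0),\quad \Lambda=\frac M2\int_0^{k^2}\frac{G(\gamma)}{\pi\eta_\gamma\sqrt\gamma}\widehat{\mathcal R}(\beta-\sqrt\gamma)d\gamma,\quad \Theta=M\int_0^{k^2}\frac{G(\gamma)}{\pi\eta_\gamma\sqrt\gamma}\int_0^\infty\mathcal R(z)\sin[(\sqrt\gamma-\beta)z]dz\,d\gamma,$$ $$\kappa^{\rm ev}=M\int_{-\infty}^0\frac{G(\gamma)}{\pi\eta_\gamma\sqrt{|\gamma|}}\int_0^\infty\mathcal R(z)\cos(\beta z)e^{-\sqrt{|\gamma|}z}dz\,d\gamma,\quad \kappa=-\frac{k^2(n^2-1)D^2\xi}{\beta(\frac2\eta+D)}\mathcal R(0)\sin(\xi D).$$ *)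

theory Defs
  imports "HOL-Probability.Probability"
begin

section \<open>Guided-mode parameters\<close>

text \<open>
  Arguments throughout: \<open>k\<close> is the wavenumber, \<open>n\<close> the (real) index of refraction and \<open>D\<close> the width
  of each waveguide.
\<close>

definition mode_beta :: "real \<Rightarrow> real \<Rightarrow> real \<Rightarrow> real" where
  "mode_beta k n D = (THE \<beta>. k < \<beta> \<and> \<beta> < n * k \<and>
     sqrt (n\<^sup>2 * k\<^sup>2 - \<beta>\<^sup>2) / sqrt (\<beta>\<^sup>2 - k\<^sup>2) * tan (D / 2 * sqrt (n\<^sup>2 * k\<^sup>2 - \<beta>\<^sup>2)) = 1)"

definition mode_xi :: "real \<Rightarrow> real \<Rightarrow> real \<Rightarrow> real" where
  "mode_xi k n D = sqrt (n\<^sup>2 * k\<^sup>2 - (mode_beta k n D)\<^sup>2)"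

definition mode_eta :: "real \<Rightarrow> real \<Rightarrow> real \<Rightarrow> real" where
  "mode_eta k n D = sqrt ((mode_beta k n D)\<^sup>2 - k\<^sup>2)"

definition mode_beta' :: "real \<Rightarrow> real \<Rightarrow> real \<Rightarrow> real" where
  "mode_beta' k n D = (let \<beta> = mode_beta k n D; \<xi> = mode_xi k n D; \<eta> = mode_eta k n D in
     \<eta> / (\<beta> * (1 + \<eta>\<^sup>2 / \<xi>\<^sup>2) * (1 / \<eta> + D / 2)))"


section \<open>Interface fluctuations\<close>

text \<open>
  Only the second-order consequences of stationarity are required, so strictly stationary
  square-integrable fluctuations are included.
\<close>

definition stationary_with_covariance ::
    "'b measure \<Rightarrow> (real \<Rightarrow> 'b \<Rightarrow> real) \<Rightarrow> (real \<Rightarrow> real) \<Rightarrow> bool" where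
  "stationary_with_covariance N \<nu> R \<longleftrightarrow>
     prob_space N \<and>
     (\<forall>z. \<nu> z \<in> borel_measurable N \<and> integrable N (\<lambda>\<omega>. (\<nu> z \<omega>)\<^sup>2)) \<and>
     (\<exists>m. \<forall>z. (LINT \<omega>|N. \<nu> z \<omega>) = m \<and>
            (\<forall>h. (LINT \<omega>|N. (\<nu> z \<omega> - m) * (\<nu> (z + h) \<omega> - m)) = R h))"

definition smooth_real :: "(real \<Rightarrow> real) \<Rightarrow> bool" where
  "smooth_real R \<longleftrightarrow> (\<forall>m x. (deriv ^^ m) R differentiable (at x))"

definition cov_hat :: "(real \<Rightarrow> real) \<Rightarrow> real \<Rightarrow> complex" where
  "cov_hat R \<kappa> = (LINT z|lborel. complex_of_real (R z) * exp (\<i> * complex_of_real (\<kappa> * z)))"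


section \<open>Effective coefficients\<close>

definition xi_rad :: "real \<Rightarrow> real \<Rightarrow> real \<Rightarrow> real" where
  "xi_rad k n \<gamma> = sqrt (k\<^sup>2 * n\<^sup>2 - \<gamma>)"

definition eta_rad :: "real \<Rightarrow> real \<Rightarrow> real" where
  "eta_rad k \<gamma> = sqrt (k\<^sup>2 - \<gamma>)"

definition G_rad :: "real \<Rightarrow> real \<Rightarrow> real \<Rightarrow> real \<Rightarrow> real" where
  "G_rad k n D \<gamma> =
     (let q = (xi_rad k n \<gamma>)\<^sup>2 / (eta_rad k \<gamma>)\<^sup>2; s = (sin (xi_rad k n \<gamma> * D))\<^sup>2 in
        (2 * q + s * (1 - q)) / (4 * q + s * (1 - q)\<^sup>2))"

definition coef_M :: "real \<Rightarrow> real \<Rightarrow> real \<Rightarrow> real" where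
  "coef_M k n D =
     k^4 * (n\<^sup>2 - 1)\<^sup>2 * D\<^sup>2 / (mode_beta k n D * (2 / mode_eta k n D + D))
       * (cos (mode_xi k n D * D / 2))\<^sup>2"

definition coef_Gamma :: "real \<Rightarrow> real \<Rightarrow> real \<Rightarrow> (real \<Rightarrow> real) \<Rightarrow> real" where
  "coef_Gamma k n D R =
     k^4 * (n\<^sup>2 - 1)\<^sup>2 * D\<^sup>2 / ((mode_beta k n D)\<^sup>2 * (2 / mode_eta k n D + D)\<^sup>2)
       * (cos (mode_xi k n D * D / 2))^4 * Re (cov_hat R 0)"

definition coef_Lambda :: "real \<Rightarrow> real \<Rightarrow> real \<Rightarrow> (real \<Rightarrow> real) \<Rightarrow> real" where
  "coef_Lambda k n D R =
     coef_M k n D / 2 *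
       (LINT \<gamma>:{0<..<k\<^sup>2}|lborel. G_rad k n D \<gamma> / (pi * eta_rad k \<gamma> * sqrt \<gamma>)
          * Re (cov_hat R (mode_beta k n D - sqrt \<gamma>)))"

definition coef_Theta :: "real \<Rightarrow> real \<Rightarrow> real \<Rightarrow> (real \<Rightarrow> real) \<Rightarrow> real" where
  "coef_Theta k n D R =
     coef_M k n D *
       (LINT \<gamma>:{0<..<k\<^sup>2}|lborel. G_rad k n D \<gamma> / (pi * eta_rad k \<gamma> * sqrt \<gamma>)
          * (LINT z:{0<..}|lborel. R z * sin ((sqrt \<gamma> - mode_beta k n D) * z)))"

definition coef_kappa_ev :: "real \<Rightarrow> real \<Rightarrow> real \<Rightarrow> (real \<Rightarrow> real) \<Rightarrow> real" where
  "coef_kappa_ev k n D R =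
     coef_M k n D *
       (LINT \<gamma>:{..<0}|lborel. G_rad k n D \<gamma> / (pi * eta_rad k \<gamma> * sqrt \<bar>\<gamma>\<bar>)
          * (LINT z:{0<..}|lborel. R z * cos (mode_beta k n D * z) * exp (- sqrt \<bar>\<gamma>\<bar> * z)))"

definition coef_kappa :: "real \<Rightarrow> real \<Rightarrow> real \<Rightarrow> (real \<Rightarrow> real) \<Rightarrow> real" where
  "coef_kappa k n D R =
     - (k\<^sup>2 * (n\<^sup>2 - 1) * D\<^sup>2 * mode_xi k n D) / (mode_beta k n D * (2 / mode_eta k n D + D))
       * R 0 * sin (mode_xi k n D * D)"


section \<open>The differential operators\<close>

text \<open>
  Functions of \<open>(u\<^sub>+, cnj u\<^sub>+, u\<^sub>-, cnj u\<^sub>-)\<close> are represented as functions \<open>f\<close> of the pair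
  \<open>(u\<^sub>+, u\<^sub>-)\<close>, differentiable over the reals. For a unit vector \<open>e\<close> (\<open>(1, 0)\<close> for \<open>u\<^sub>+\<close>, \<open>(0, 1)\<close> for
  \<open>u\<^sub>-\<close>), \<open>d_hol e\<close> and \<open>d_bar e\<close> are the derivatives with respect to that coordinate and to its
  conjugate; \<open>cscale \<i> e\<close> is the direction of its imaginary part.
\<close>

type_synonym test_fun = "complex \<times> complex \<Rightarrow> complex"

definition dir_deriv :: "complex \<times> complex \<Rightarrow> test_fun \<Rightarrow> test_fun" where
  "dir_deriv h f x = frechet_derivative f (at x) h"

definition cscale :: "complex \<Rightarrow> complex \<times> complex \<Rightarrow> complex \<times> complex" where
  "cscale c x = (c * fst x, c * snd x)"

definition d_hol :: "complex \<times> complex \<Rightarrow> test_fun \<Rightarrow> test_fun" where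
  "d_hol e f x = (dir_deriv e f x - \<i> * dir_deriv (cscale \<i> e) f x) / 2"

definition d_bar :: "complex \<times> complex \<Rightarrow> test_fun \<Rightarrow> test_fun" where
  "d_bar e f x = (dir_deriv e f x + \<i> * dir_deriv (cscale \<i> e) f x) / 2"

abbreviation "e_plus \<equiv> (1, 0) :: complex \<times> complex"
abbreviation "e_minus \<equiv> (0, 1) :: complex \<times> complex"

text \<open>The single-waveguide operator in the coordinate \<open>u\<close>, with \<open>K = \<kappa> + \<kappa>\<^sup>e\<^sup>v\<close>.\<close>

definition gen_single ::
    "real \<Rightarrow> real \<Rightarrow> real \<Rightarrow> real \<Rightarrow> (complex \<times> complex \<Rightarrow> complex) \<Rightarrow> complex \<times> complex
       \<Rightarrow> test_fun \<Rightarrow> test_fun" where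
  "gen_single \<Gamma> \<Lambda> \<Theta> K coord e f x = (let u = coord x in
     \<Gamma> * (2 * (cmod u)\<^sup>2 * d_hol e (d_bar e f) x
          - u\<^sup>2 * d_hol e (d_hol e f) x - (cnj u)\<^sup>2 * d_bar e (d_bar e f) x
          - u * d_hol e f x - cnj u * d_bar e f x)
     - (\<Lambda> + \<i> * \<Theta>) / 2 * u * d_hol e f x
     - (\<Lambda> - \<i> * \<Theta>) / 2 * cnj u * d_bar e f x
     + \<i> * K * (u * d_hol e f x - cnj u * d_bar e f x))"

definition gen_coupling :: "real \<Rightarrow> test_fun \<Rightarrow> test_fun" where
  "gen_coupling \<beta>' f x = (case x of (up, um) \<Rightarrow>
     \<i> * \<beta>' * (up * d_hol e_minus f x + um * d_hol e_plus f x
              - cnj up * d_bar e_minus f x - cnj um * d_bar e_plus f x))"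

definition weak_generator ::
    "real \<Rightarrow> real \<Rightarrow> real \<Rightarrow> (real \<Rightarrow> real) \<Rightarrow> real \<Rightarrow> test_fun \<Rightarrow> test_fun" where
  "weak_generator k n D R \<theta> f x =
     (let L = gen_single (coef_Gamma k n D R) (coef_Lambda k n D R) (coef_Theta k n D R)
                (coef_kappa k n D R + coef_kappa_ev k n D R)
      in L fst e_plus f x + L snd e_minus f x + \<theta> * gen_coupling (mode_beta' k n D) f x)"


section \<open>Markov processes with a given generator\<close>

definition C_zero :: "('a::real_normed_vector \<Rightarrow> complex) set" where
  "C_zero = {f. continuous_on UNIV f \<and> (f \<longlongrightarrow> 0) at_infinity}"

definition C1 :: "test_fun \<Rightarrow> bool" where
  "C1 f \<longleftrightarrow> (\<forall>x. f differentiable (at x)) \<and> (\<forall>h. continuous_on UNIV (dir_deriv h f))"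

definition C2_compact :: "test_fun set" where
  "C2_compact = {f. C1 f \<and> (\<forall>h. C1 (dir_deriv h f)) \<and> compact (closure {x. f x \<noteq> 0})}"

definition markov_kernels :: "(real \<Rightarrow> 'a::topological_space \<Rightarrow> 'a measure) \<Rightarrow> bool" where
  "markov_kernels P \<longleftrightarrow>
     (\<forall>t\<ge>0. P t \<in> borel \<rightarrow>\<^sub>M prob_algebra borel) \<and>
     (\<forall>x. P 0 x = return borel x) \<and>
     (\<forall>s\<ge>0. \<forall>t\<ge>0. \<forall>x. P (s + t) x = P s x \<bind> P t)"

definition semigroup_op ::
    "(real \<Rightarrow> 'a \<Rightarrow> 'a measure) \<Rightarrow> real \<Rightarrow> ('a \<Rightarrow> complex) \<Rightarrow> 'a \<Rightarrow> complex" where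
  "semigroup_op P t f x = (LINT y|P t x. f y)"

definition feller :: "(real \<Rightarrow> 'a::real_normed_vector \<Rightarrow> 'a measure) \<Rightarrow> bool" where
  "feller P \<longleftrightarrow> markov_kernels P \<and>
     (\<forall>f\<in>C_zero. (\<forall>t\<ge>0. semigroup_op P t f \<in> C_zero) \<and>
        uniform_limit UNIV (\<lambda>t. semigroup_op P t f) f (at_right 0))"

text \<open>\<open>f\<close> lies in the domain of the infinitesimal generator of \<open>P\<close>, and is mapped to \<open>g\<close>.\<close>

definition infinitesimal_generator ::
    "(real \<Rightarrow> 'a::real_normed_vector \<Rightarrow> 'a measure) \<Rightarrow> ('a \<Rightarrow> complex) \<Rightarrow> ('a \<Rightarrow> complex) \<Rightarrow> bool" where
  "infinitesimal_generator P f g \<longleftrightarrow> f \<in> C_zero \<and> g \<in> C_zero \<and>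
     uniform_limit UNIV (\<lambda>t x. (semigroup_op P t f x - f x) /\<^sub>R t) g (at_right 0)"

definition natural_sigma ::
    "'w measure \<Rightarrow> (real \<Rightarrow> 'w \<Rightarrow> 'a::topological_space) \<Rightarrow> real \<Rightarrow> 'w measure" where
  "natural_sigma M X s =
     sigma (space M) {X r -` A \<inter> space M | r A. 0 \<le> r \<and> r \<le> s \<and> A \<in> sets borel}"

definition markov_process ::
    "'w measure \<Rightarrow> (real \<Rightarrow> 'w \<Rightarrow> 'a::topological_space) \<Rightarrow> (real \<Rightarrow> 'a \<Rightarrow> 'a measure) \<Rightarrow> bool" where
  "markov_process M X P \<longleftrightarrow>
     prob_space M \<and> (\<forall>t\<ge>0. X t \<in> borel_measurable M) \<and>
     (\<forall>s\<ge>0. \<forall>t\<ge>0. \<forall>A\<in>sets borel. AE \<omega> in M.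
        real_cond_exp M (natural_sigma M X s) (\<lambda>\<omega>. indicator A (X (s + t) \<omega>)) \<omega>
          = measure (P t (X s \<omega>)) A)"

text \<open>
  A differential expression \<open>L\<close> determines the generator through its action on compactly
  supported \<open>C\<^sup>2\<close> functions. Right-continuity selects the usual version of the process; without
  it, path-wise statements holding simultaneously at all times would be meaningless.
\<close>

definition markov_process_with_generator ::
    "'w measure \<Rightarrow> (real \<Rightarrow> 'w \<Rightarrow> complex \<times> complex) \<Rightarrow> (test_fun \<Rightarrow> test_fun) \<Rightarrow> bool" where
  "markov_process_with_generator M X L \<longleftrightarrow>
     (\<exists>P. feller P \<and> markov_process M X P \<and> (\<forall>f\<in>C2_compact. infinitesimal_generator P f (L f))) \<and>
     (AE \<omega> in M. \<forall>t\<ge>0. continuous (at_right t) (\<lambda>s. X s \<omega>))"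

definition power_imbalance :: "(real \<Rightarrow> 'w \<Rightarrow> complex) \<Rightarrow> (real \<Rightarrow> 'w \<Rightarrow> complex) \<Rightarrow> real \<Rightarrow> 'w \<Rightarrow> real" where
  "power_imbalance up um z \<omega> =
     ((cmod (up z \<omega>))\<^sup>2 - (cmod (um z \<omega>))\<^sup>2) / ((cmod (up z \<omega>))\<^sup>2 + (cmod (um z \<omega>))\<^sup>2)"

end

theory Submission
  imports Defs
begin

text \<open>
  In each guide \<open>u \<partial>\<^sub>u\<close> minus its conjugate is \<open>- \<i>\<close> times the derivative along the phase of \<open>u\<close>, and
  the factor of \<open>\<Gamma>\<close> is minus its square. So the \<open>\<Gamma>\<close> part is \<open>\<Gamma>\<close> times the second phase
  derivative: a diffusion of the two phases that is independent in the two guides. The \<open>\<Theta>\<close> and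
  \<open>\<kappa>\<close> parts rotate both phases equally, the \<open>\<Lambda>\<close> part is a radial contraction, and the coupling
  generates a unitary rotation of the pair of amplitudes. On the quadratic forms

    \<^item> \<open>S = |u\<^sub>+|\<^sup>2 + |u\<^sub>-|\<^sup>2\<close> (\<open>total_power\<close>),
    \<^item> \<open>m = |u\<^sub>+|\<^sup>2 - |u\<^sub>-|\<^sup>2\<close> (\<open>power_difference\<close>),
    \<^item> \<open>w = 2 Im (u\<^sub>+ cnj u\<^sub>-)\<close> (\<open>power_exchange\<close>),

  the generator \<open>L\<close> therefore closes: with \<open>\<omega> = 2\<theta>\<beta>'\<close>,
  \<open>L S = - \<Lambda> S\<close>, \<open>L m = - \<Lambda> m + \<omega> w\<close> and \<open>L w = - \<Lambda> w - \<omega> m - 2\<Gamma> w\<close>.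
  Since \<open>L\<close> acts on functions of \<open>S\<close> as the vector field \<open>- \<Lambda> S \<partial>\<^sub>S\<close>, the function
  \<open>v\<^sub>z = (c + \<sigma>(a m + b w)) G(\<sigma> S)\<close>, \<open>\<sigma> = exp (- \<Lambda> z)\<close>, solves \<open>\<partial>\<^sub>z v = L v\<close> as soon as
  \<open>a' = - \<omega> b\<close> and \<open>b' = \<omega> a - 2\<Gamma> b\<close>. The factor \<open>G\<close> makes \<open>v\<^sub>z\<close> a compactly supported \<open>C\<^sup>2\<close>
  function, so that it lies in the known part of the domain of the generator.

  A solution of the backward equation inside the domain is given by the semigroup
  (\<open>backward_equation_solution\<close>), hence the expectation of \<open>v\<^sub>0\<close> at \<open>z\<close> is \<open>v\<^sub>z\<close> at the starting
  point (\<open>expectation_test\<close>). Two choices give the theorem.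

    \<^item> \<open>c = 1\<close>, \<open>a = b = 0\<close>, and \<open>G\<close> with the strict maximum \<open>1\<close> at \<open>p = \<sigma> S\<^sub>0\<close>: then
      \<open>G(S(z))\<close> has expectation \<open>1\<close>, which forces \<open>S(z) = p\<close> almost surely. Right-continuity extends
      this from rational \<open>z\<close> to all \<open>z\<close> at once.
    \<^item> \<open>c = 0\<close>, \<open>a(0) = 1\<close>, \<open>b(0) = 0\<close>: because \<open>S(z)\<close> is now a known number, dividing by it turns the
      expectation of \<open>m G(S)\<close> into that of the imbalance, which equals \<open>(a m\<^sub>0 + b w\<^sub>0) / S\<^sub>0\<close>. Both
      \<open>a\<close> and \<open>b\<close> solve the damped oscillator equation.

  The closed formulas distinguish the cases by comparing \<open>\<omega>\<close>, not its absolute value, with \<open>\<Gamma>\<close>;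
  this is why \<open>\<beta>' \<ge> 0\<close> is required, and hence that the dispersion relation really determines a
  propagation constant in \<open>(k, nk)\<close> (\<open>mode_beta_bounds\<close>).
\<close>


section \<open>Feller semigroups and the backward equation\<close>

text \<open>
  For each slope \<open>e > 0\<close>, the set of points where \<open>f\<close> has moved by at most \<open>e (x - a)\<close> is compact, and
  the hypothesis at its largest point pushes that point further right unless it is \<open>b\<close>. A
  one-sided hypothesis is what a generator provides, since a semigroup is differentiated
  only towards positive times.
\<close>

lemma constant_if_right_derivative_zero:
  fixes f :: "real \<Rightarrow> real"
  assumes "a \<le> b" and cont: "continuous_on {a..b} f"
    and deriv: "\<And>x e. a \<le> x \<Longrightarrow> x < b \<Longrightarrow> e > 0 \<Longrightarrow>
      \<exists>d>0. \<forall>h. 0 < h \<longrightarrow> h < d \<longrightarrow> x + h \<le> b \<longrightarrow> \<bar>f (x + h) - f x\<bar> \<le> e * h"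
  shows "f b = f a"
proof -
  have bound: "\<bar>f b - f a\<bar> \<le> e * (b - a)" if "e > 0" for e
  proof -
    define C where "C = {x\<in>{a..b}. \<bar>f x - f a\<bar> - e * (x - a) \<le> 0}"
    have "C = {a..b} \<inter> (\<lambda>x. \<bar>f x - f a\<bar> - e * (x - a)) -` {..0}"
      by (auto simp: C_def)
    then have "closed C"
      by (simp add: continuous_closed_preimage continuous_intros cont)
    moreover have "bounded C"
      by (rule bounded_subset[of "{a..b}"]) (auto simp: C_def)
    ultimately have "compact C"
      by (simp add: compact_eq_bounded_closed)
    moreover have "a \<in> C"
      using \<open>a \<le> b\<close> by (simp add: C_def)
    ultimately obtain c where c: "c \<in> C" "\<And>x. x \<in> C \<Longrightarrow> x \<le> c"
      by (metis compact_attains_sup empty_iff)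
    have "c = b"
    proof (rule ccontr)
      assume "c \<noteq> b"
      then have "a \<le> c" "c < b"
        using c(1) by (auto simp: C_def)
      from deriv[OF this \<open>e > 0\<close>] obtain d where d: "d > 0"
        "\<And>h. 0 < h \<Longrightarrow> h < d \<Longrightarrow> c + h \<le> b \<Longrightarrow> \<bar>f (c + h) - f c\<bar> \<le> e * h"
        by blast
      define h where "h = min (d / 2) (b - c)"
      have h: "0 < h" "h < d" "c + h \<le> b"
        using d(1) \<open>c < b\<close> by (auto simp: h_def)
      have "\<bar>f (c + h) - f a\<bar> \<le> e * h + e * (c - a)"
        using d(2)[OF h] c(1) by (auto simp: C_def)
      then have "c + h \<in> C"
        using h \<open>a \<le> c\<close> by (simp add: C_def algebra_simps)
      then show False
        using c(2) h(1) by fastforce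
    qed
    then show ?thesis
      using c(1) by (simp add: C_def)
  qed
  have "\<bar>f b - f a\<bar> \<le> (0::real)"
  proof (rule field_le_epsilon)
    fix e :: real assume "e > 0"
    have "\<bar>f b - f a\<bar> \<le> e / (b - a + 1) * (b - a)"
      using bound[of "e / (b - a + 1)"] \<open>e > 0\<close> \<open>a \<le> b\<close> by simp
    also have "\<dots> \<le> e"
      using \<open>e > 0\<close> \<open>a \<le> b\<close> by (simp add: field_simps)
    finally show "\<bar>f b - f a\<bar> \<le> 0 + e"
      by simp
  qed
  then show ?thesis
    by simp
qed

lemma C_zero_bounded:
  fixes f :: "'a::euclidean_space \<Rightarrow> complex"
  assumes "f \<in> C_zero"
  obtains B where "\<And>x. norm (f x) \<le> B"
proof -
  have cont: "continuous_on UNIV f" and lim: "(f \<longlongrightarrow> 0) at_infinity"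
    using assms by (auto simp: C_zero_def)
  have "eventually (\<lambda>x. norm (f x) < 1) at_infinity"
    using tendstoD[OF lim, of 1] by simp
  then obtain r where r: "\<And>x. r \<le> norm x \<Longrightarrow> norm (f x) < 1"
    by (auto simp: eventually_at_infinity)
  have "compact (f ` cball 0 r)"
    by (intro compact_continuous_image continuous_on_subset[OF cont]) auto
  then obtain B where B: "\<And>x. x \<in> cball 0 r \<Longrightarrow> norm (f x) \<le> B"
    by (metis bounded_iff compact_imp_bounded imageI)
  have "norm (f x) \<le> max B 1" for x
    using r[of x] B[of x] by (cases "r \<le> norm x") auto
  then show ?thesis
    by (rule that)
qed

text \<open>
  All functions to which the semigroup is applied below are real, so it is handled through
  real expectations; \<open>semigroup_op_of_real\<close> connects these with the complex operators.
\<close>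

locale feller_semigroup =
  fixes P :: "real \<Rightarrow> 'a::euclidean_space \<Rightarrow> 'a measure"
  assumes feller: "feller P"
begin

definition E :: "real \<Rightarrow> ('a \<Rightarrow> real) \<Rightarrow> 'a \<Rightarrow> real" where
  "E t f x = (LINT y|P t x. f y)"

lemma kernel: "t \<ge> 0 \<Longrightarrow> P t \<in> borel \<rightarrow>\<^sub>M prob_algebra borel"
  using feller by (auto simp: feller_def markov_kernels_def)

lemma subprob_kernel: "t \<ge> 0 \<Longrightarrow> P t \<in> borel \<rightarrow>\<^sub>M subprob_algebra borel"
  by (intro measurable_prob_algebraD kernel)

lemma kernel_space:
  assumes "t \<ge> 0"
  shows "sets (P t x) = sets borel" "space (P t x) = UNIV" "prob_space (P t x)"
proof -
  have "P t x \<in> space (prob_algebra borel)"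
    using kernel[OF assms] by (auto dest: measurable_space)
  then show *: "sets (P t x) = sets borel" "prob_space (P t x)"
    by (auto simp: space_prob_algebra)
  show "space (P t x) = UNIV"
    using sets_eq_imp_space_eq[OF *(1)] by simp
qed

lemma integrable_kernel:
  assumes "t \<ge> 0" "f \<in> borel_measurable borel" "\<And>x. \<bar>f x\<bar> \<le> B"
  shows "integrable (P t x) (f :: 'a \<Rightarrow> real)"
proof -
  interpret prob_space "P t x"
    by (rule kernel_space[OF assms(1)])
  have "f \<in> borel_measurable (P t x)"
    using assms(2) measurable_cong_sets[OF kernel_space(1)[OF assms(1)] refl] by blast
  then show ?thesis
    using assms(3) by (intro integrable_const_bound[where B=B]) auto
qed

lemma E_bound:
  assumes "t \<ge> 0" "f \<in> borel_measurable borel" "\<And>x. \<bar>f x\<bar> \<le> B"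
  shows "\<bar>E t f x\<bar> \<le> B"
proof -
  interpret prob_space "P t x"
    by (rule kernel_space[OF assms(1)])
  have "integrable (P t x) f"
    by (rule integrable_kernel[OF assms])
  then have "E t f x \<le> B" "- B \<le> E t f x"
    unfolding E_def using assms(3)
    by (auto intro!: integral_le_const integral_ge_const AE_I2 simp: abs_le_iff minus_le_iff)
  then show ?thesis
    by linarith
qed

lemma E_diff:
  assumes "t \<ge> 0" "f \<in> borel_measurable borel" "g \<in> borel_measurable borel"
    "\<And>x. \<bar>f x\<bar> \<le> B" "\<And>x. \<bar>g x\<bar> \<le> C"
  shows "E t (\<lambda>x. f x - g x) x = E t f x - E t g x"
  unfolding E_def using assms by (intro Bochner_Integration.integral_diff integrable_kernel)

lemma E_zero: "E 0 f x = f x" if "f \<in> borel_measurable borel"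
  using feller that by (simp add: E_def feller_def markov_kernels_def integral_return)

lemma E_add:
  assumes "s \<ge> 0" "t \<ge> 0" "f \<in> borel_measurable borel" "\<And>x. \<bar>f x\<bar> \<le> B"
  shows "E (s + t) f x = E s (E t f) x"
proof -
  interpret prob_space "P s x"
    by (rule kernel_space[OF assms(1)])
  have "E (s + t) f x = (LINT y|(P s x \<bind> P t). f y)"
    using feller assms by (simp add: E_def feller_def markov_kernels_def)
  also have "\<dots> = (LINT y|P s x. E t f y)"
    unfolding E_def
  proof (rule integral_bind[where K=borel and B=B and B'=1])
    show "P t \<in> P s x \<rightarrow>\<^sub>M subprob_algebra borel"
      using subprob_kernel[OF assms(2)] measurable_cong_sets[OF kernel_space(1)[OF assms(1)] refl] by blast
    show "AE y in P s x. emeasure (P t y) (space (P t y)) \<le> ennreal 1"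
      using kernel_space(3)[OF assms(2)] by (auto simp: prob_space.emeasure_space_1)
    show "finite_measure (P s x)"
      by unfold_locales
  qed (use assms in auto)
  finally show ?thesis
    by (simp add: E_def)
qed

lemma semigroup_op_of_real: "semigroup_op P t (\<lambda>x. complex_of_real (f x)) x = of_real (E t f x)"
  by (simp add: semigroup_op_def E_def)

lemma real_C_zero:
  assumes "(\<lambda>x. complex_of_real (f x)) \<in> C_zero"
  shows "f \<in> borel_measurable borel" "\<exists>B. \<forall>x. \<bar>f x\<bar> \<le> B"
    "t \<ge> 0 \<Longrightarrow> (\<lambda>x. complex_of_real (E t f x)) \<in> C_zero"
proof -
  have "continuous_on UNIV (\<lambda>x. Re (complex_of_real (f x)))"
    using assms by (intro continuous_on_Re) (auto simp: C_zero_def)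
  then show "f \<in> borel_measurable borel"
    by (simp add: borel_measurable_continuous_onI)
  show "\<exists>B. \<forall>x. \<bar>f x\<bar> \<le> B"
    using C_zero_bounded[OF assms] by auto
  show "(\<lambda>x. complex_of_real (E t f x)) \<in> C_zero" if "t \<ge> 0"
    using feller assms that unfolding feller_def semigroup_op_of_real[symmetric, abs_def] by blast
qed

lemma strongly_continuous:
  assumes "(\<lambda>x. complex_of_real (f x)) \<in> C_zero" "e > 0"
  shows "\<exists>d>0. \<forall>h. 0 < h \<longrightarrow> h < d \<longrightarrow> (\<forall>x. \<bar>E h f x - f x\<bar> \<le> e)"
proof -
  have "uniform_limit UNIV (\<lambda>t. semigroup_op P t (\<lambda>x. complex_of_real (f x))) (\<lambda>x. complex_of_real (f x)) (at_right 0)"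
    using feller assms(1) unfolding feller_def by blast
  from uniform_limitD[OF this \<open>e > 0\<close>] show ?thesis
    unfolding eventually_at_right_field semigroup_op_of_real dist_norm
      of_real_diff[symmetric] norm_of_real
    by (force intro: less_imp_le)
qed

lemma generator_quotient:
  assumes "infinitesimal_generator P (\<lambda>x. complex_of_real (f x)) (\<lambda>x. complex_of_real (g x))" "e > 0"
  shows "\<exists>d>0. \<forall>h. 0 < h \<longrightarrow> h < d \<longrightarrow> (\<forall>x. \<bar>E h f x - f x - h * g x\<bar> \<le> e * h)"
proof -
  have "uniform_limit UNIV (\<lambda>t x. (semigroup_op P t (\<lambda>x. complex_of_real (f x)) x - complex_of_real (f x)) /\<^sub>R t)
     (\<lambda>x. complex_of_real (g x)) (at_right 0)"
    using assms(1) unfolding infinitesimal_generator_def by blast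
  from uniform_limitD[OF this \<open>e > 0\<close>] obtain d where d: "d > 0"
    "\<And>h x. 0 < h \<Longrightarrow> h < d \<Longrightarrow> dist ((complex_of_real (E h f x) - complex_of_real (f x)) /\<^sub>R h) (complex_of_real (g x)) < e"
    unfolding eventually_at_right_field semigroup_op_of_real by auto
  have "\<bar>E h f x - f x - h * g x\<bar> \<le> e * h" if "0 < h" "h < d" for h x
  proof -
    have "dist ((complex_of_real (E h f x) - complex_of_real (f x)) /\<^sub>R h) (complex_of_real (g x))
        = norm (complex_of_real ((E h f x - f x) / h - g x))"
      by (simp add: dist_norm scaleR_conv_of_real divide_inverse mult.commute)
    then have "\<bar>(E h f x - f x) / h - g x\<bar> < e"
      using d(2)[OF that, of x] by (simp only: norm_of_real)
    then have "h * \<bar>(E h f x - f x) / h - g x\<bar> \<le> h * e"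
      using \<open>0 < h\<close> by simp
    moreover have "h * \<bar>(E h f x - f x) / h - g x\<bar> = \<bar>E h f x - f x - h * g x\<bar>"
      using \<open>0 < h\<close> by (simp add: abs_mult[symmetric, of h] abs_of_pos[of h] field_simps flip: abs_mult_pos')
    ultimately show ?thesis
      by (simp add: mult.commute)
  qed
  then show ?thesis
    using \<open>d > 0\<close> by blast
qed

text \<open>
  Uniqueness for the backward equation. The interpolation \<open>\<phi>(s) = P\<^sub>t\<^sub>-\<^sub>s v\<^sub>s\<close> runs from
  \<open>P\<^sub>t v\<^sub>0\<close> to \<open>v\<^sub>t\<close>, and its right derivative vanishes because an increment of length \<open>h\<close> equals
  \<open>P\<^sub>t\<^sub>-\<^sub>s\<^sub>-\<^sub>h\<close> applied to \<open>v\<^sub>s\<^sub>+\<^sub>h - P\<^sub>h v\<^sub>s\<close>. Both terms are \<open>v\<^sub>s + h g\<^sub>s + o(h)\<close> uniformly in space, and the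
  semigroup is a contraction. Left continuity comes from strong
  continuity of the semigroup and continuity of \<open>v\<close> in time.
\<close>

lemma backward_equation_solution:
  fixes v g :: "real \<Rightarrow> 'a \<Rightarrow> real"
  assumes gen: "\<And>s. infinitesimal_generator P (\<lambda>x. complex_of_real (v s x)) (\<lambda>x. complex_of_real (g s x))"
    and deriv: "\<And>s e. e > 0 \<Longrightarrow>
      \<exists>d>0. \<forall>h. \<bar>h\<bar> < d \<longrightarrow> (\<forall>x. \<bar>v (s + h) x - v s x - h * g s x\<bar> \<le> e * \<bar>h\<bar>)"
    and "t \<ge> 0"
  shows "E t (v 0) x = v t x"
proof -
  have C0: "(\<lambda>x. complex_of_real (v s x)) \<in> C_zero" "(\<lambda>x. complex_of_real (g s x)) \<in> C_zero" for s
    using gen by (auto simp: infinitesimal_generator_def)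
  note meas = real_C_zero(1)[OF C0(1)]
  have bdd: "\<exists>B. \<forall>x. \<bar>v s x\<bar> \<le> B" for s
    by (rule real_C_zero(2)[OF C0(1)])
  have measE: "E h (v s) \<in> borel_measurable borel" if "h \<ge> 0" for h s
    by (rule real_C_zero(1)[OF real_C_zero(3)[OF C0(1) that]])
  have contract: "\<bar>E r (v a) x - E (r + h) (v b) x\<bar> \<le> B"
    if "r \<ge> 0" "h \<ge> 0" and B: "\<And>y. \<bar>v a y - E h (v b) y\<bar> \<le> B" for r h a b B
  proof -
    obtain B1 B2 where B12: "\<And>x. \<bar>v a x\<bar> \<le> B1" "\<And>x. \<bar>v b x\<bar> \<le> B2"
      using bdd by meson
    have "E (r + h) (v b) x = E r (E h (v b)) x"
      by (rule E_add[OF that(1,2) meas B12(2)])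
    moreover have "E r (\<lambda>y. v a y - E h (v b) y) x = E r (v a) x - E r (E h (v b)) x"
      by (rule E_diff[OF that(1) meas measE[OF that(2)] B12(1) E_bound[OF that(2) meas B12(2)]])
    moreover have "\<bar>E r (\<lambda>y. v a y - E h (v b) y) x\<bar> \<le> B"
      by (rule E_bound[OF that(1) _ B]) (use meas measE[OF that(2)] in measurable)
    ultimately show ?thesis
      by simp
  qed
  define \<phi> where "\<phi> s = E (t - s) (v s) x" for s
  have right: "\<exists>d>0. \<forall>h. 0 < h \<longrightarrow> h < d \<longrightarrow> s + h \<le> t \<longrightarrow> \<bar>\<phi> (s + h) - \<phi> s\<bar> \<le> e * h"
    if "e > 0" for s e
  proof -
    obtain d1 where d1: "d1 > 0"
      "\<And>h x. \<bar>h\<bar> < d1 \<Longrightarrow> \<bar>v (s + h) x - v s x - h * g s x\<bar> \<le> e / 2 * \<bar>h\<bar>"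
      using deriv[of "e / 2" s] \<open>e > 0\<close> by auto
    obtain d2 where d2: "d2 > 0"
      "\<And>h x. 0 < h \<Longrightarrow> h < d2 \<Longrightarrow> \<bar>E h (v s) x - v s x - h * g s x\<bar> \<le> e / 2 * h"
      using generator_quotient[OF gen[of s], of "e / 2"] \<open>e > 0\<close> by auto
    have "\<bar>\<phi> (s + h) - \<phi> s\<bar> \<le> e * h" if h: "0 < h" "h < min d1 d2" "s + h \<le> t" for h
    proof -
      have "\<bar>E (t - s - h) (v (s + h)) x - E (t - s - h + h) (v s) x\<bar> \<le> e * h"
      proof (rule contract)
        fix y
        show "\<bar>v (s + h) y - E h (v s) y\<bar> \<le> e * h"
          using d1(2)[of h y] d2(2)[of h y] h by linarith
      qed (use h in auto)
      then show ?thesis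
        by (simp add: \<phi>_def algebra_simps)
    qed
    then show ?thesis
      using d1(1) d2(1) by (intro exI[of _ "min d1 d2"]) auto
  qed
  have left: "\<exists>d>0. \<forall>h. 0 < h \<longrightarrow> h < d \<longrightarrow> \<bar>\<phi> s - \<phi> (s - h)\<bar> \<le> e"
    if "e > 0" "s \<le> t" for s e
  proof -
    obtain B where B: "\<And>x. \<bar>g s x\<bar> \<le> B"
      using real_C_zero(2)[OF C0(2)[of s]] by blast
    have "B \<ge> 0"
      using B[of 0] by linarith
    obtain d1 where d1: "d1 > 0"
      "\<And>h x. \<bar>h\<bar> < d1 \<Longrightarrow> \<bar>v (s + h) x - v s x - h * g s x\<bar> \<le> 1 * \<bar>h\<bar>"
      using deriv[of 1 s] by auto
    obtain d2 where d2: "d2 > 0"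
      "\<And>h x. 0 < h \<Longrightarrow> h < d2 \<Longrightarrow> \<bar>E h (v s) x - v s x\<bar> \<le> e / 2"
      using strongly_continuous[OF C0(1)[of s], of "e / 2"] \<open>e > 0\<close> by auto
    define d where "d = min (min d1 d2) (e / (2 * (B + 1)))"
    have "d > 0"
      using d1(1) d2(1) \<open>B \<ge> 0\<close> \<open>e > 0\<close> by (simp add: d_def)
    have "\<bar>\<phi> s - \<phi> (s - h)\<bar> \<le> e" if h: "0 < h" "h < d" for h
    proof -
      have h': "h < d1" "h < d2" "h \<le> e / (2 * (B + 1))"
        using h by (auto simp: d_def)
      have hB: "h * (B + 1) \<le> e / 2"
        using h'(3) \<open>B \<ge> 0\<close> by (simp add: field_simps)
      have step: "\<bar>v s y - v (s - h) y\<bar> \<le> e / 2" for y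
      proof -
        have "\<bar>v (s - h) y - v s y + h * g s y\<bar> \<le> h"
          using d1(2)[of "- h" y] h h' by simp
        moreover have "\<bar>h * g s y\<bar> \<le> h * B"
          using B[of y] h by (simp add: abs_mult)
        ultimately show ?thesis
          using hB unfolding distrib_left by linarith
      qed
      have "\<bar>E (t - s) (v s) x - E (t - s + h) (v (s - h)) x\<bar> \<le> e"
      proof (rule contract)
        fix y
        obtain B1 B2 where B12: "\<And>x. \<bar>v s x\<bar> \<le> B1" "\<And>x. \<bar>v (s - h) x\<bar> \<le> B2"
          using bdd by meson
        have "\<bar>E h (\<lambda>y. v s y - v (s - h) y) y\<bar> \<le> e / 2"
          by (rule E_bound[OF _ _ step]) (use meas h in auto)
        moreover have "E h (\<lambda>y. v s y - v (s - h) y) y = E h (v s) y - E h (v (s - h)) y"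
          by (rule E_diff[OF _ meas meas B12]) (use h in auto)
        ultimately show "\<bar>v s y - E h (v (s - h)) y\<bar> \<le> e"
          using d2(2)[of h y] h(1) h'(2) by linarith
      qed (use h \<open>s \<le> t\<close> in auto)
      then show ?thesis
        by (simp add: \<phi>_def algebra_simps)
    qed
    then show ?thesis
      using \<open>d > 0\<close> by blast
  qed
  have "continuous_on {0..t} \<phi>"
    unfolding continuous_on_iff
  proof safe
    fix s e :: real assume s: "s \<in> {0..t}" and "e > 0"
    obtain d1 where d1: "d1 > 0" "\<And>h. 0 < h \<Longrightarrow> h < d1 \<Longrightarrow> s + h \<le> t \<Longrightarrow> \<bar>\<phi> (s + h) - \<phi> s\<bar> \<le> e / 2 * h"
      using right[of "e / 2" s] \<open>e > 0\<close> by auto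
    obtain d2 where d2: "d2 > 0" "\<And>h. 0 < h \<Longrightarrow> h < d2 \<Longrightarrow> \<bar>\<phi> s - \<phi> (s - h)\<bar> \<le> e / 2"
      using left[of "e / 2" s] \<open>e > 0\<close> s by auto
    have "\<bar>\<phi> r - \<phi> s\<bar> < e" if r: "r \<in> {0..t}" "\<bar>r - s\<bar> < min 1 (min d1 d2)" for r
    proof (cases r s rule: linorder_cases)
      case less
      then have "\<bar>\<phi> s - \<phi> (s - (s - r))\<bar> \<le> e / 2"
        using r by (intro d2(2)) auto
      then have "\<bar>\<phi> s - \<phi> r\<bar> \<le> e / 2"
        by simp
      then show ?thesis
        using \<open>e > 0\<close> by linarith
    next
      case equal
      then show ?thesis
        using \<open>e > 0\<close> by simp
    next
      case greater
      have "\<bar>\<phi> r - \<phi> s\<bar> \<le> e / 2 * (r - s)"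
        using d1(2)[of "r - s"] greater r by auto
      also have "\<dots> < e"
        using r greater \<open>e > 0\<close> by (simp add: abs_less_iff)
      finally show ?thesis .
    qed
    then show "\<exists>d>0. \<forall>r\<in>{0..t}. dist r s < d \<longrightarrow> dist (\<phi> r) (\<phi> s) < e"
      using d1(1) d2(1) by (intro exI[of _ "min 1 (min d1 d2)"]) (auto simp: dist_real_def)
  qed
  from constant_if_right_derivative_zero[OF \<open>t \<ge> 0\<close> this] right have "\<phi> t = \<phi> 0"
    by blast
  then show ?thesis
    by (simp add: \<phi>_def E_zero[OF meas])
qed

end

text \<open>
  The pointwise derivative in time is uniform in space because everything happens on a compact
  space-time set, where \<open>g\<close> is uniformly continuous; the mean value inequality then bounds the remainder.
\<close>

lemma uniform_time_derivative:
  fixes v g :: "real \<Rightarrow> 'a::euclidean_space \<Rightarrow> real"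
  assumes deriv: "\<And>s x. ((\<lambda>s. v s x) has_real_derivative g s x) (at s)"
    and cont: "continuous_on UNIV (\<lambda>(s, x). g s x)"
    and supp: "\<And>\<tau> x. \<bar>\<tau> - s\<bar> \<le> 1 \<Longrightarrow> norm x > r \<Longrightarrow> v \<tau> x = 0"
    and "e > 0"
  shows "\<exists>d>0. \<forall>h. \<bar>h\<bar> < d \<longrightarrow> (\<forall>x. \<bar>v (s + h) x - v s x - h * g s x\<bar> \<le> e * \<bar>h\<bar>)"
proof -
  define K where "K = cball s 1 \<times> cball (0::'a) r"
  have "uniformly_continuous_on K (\<lambda>(s, x). g s x)"
    unfolding K_def
    by (intro compact_uniformly_continuous compact_Times compact_cball continuous_on_subset[OF cont]) auto
  then obtain d where d: "d > 0"
    "\<And>p q. p \<in> K \<Longrightarrow> q \<in> K \<Longrightarrow> dist q p < d \<Longrightarrow> dist (case q of (s, x) \<Rightarrow> g s x) (case p of (s, x) \<Rightarrow> g s x) < e"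
    using \<open>e > 0\<close> unfolding uniformly_continuous_on_def by meson
  have near: "\<bar>g \<tau> x - g s x\<bar> < e" if "\<bar>\<tau> - s\<bar> < min 1 d" "norm x \<le> r" for \<tau> x
    using d(2)[of "(s, x)" "(\<tau>, x)"] that
    by (auto simp: K_def dist_Pair_Pair dist_real_def abs_minus_commute)
  have outside: "g s x = 0" if "norm x > r" for x
  proof -
    have "((\<lambda>\<tau>. 0) has_real_derivative g s x) (at s)"
      by (rule DERIV_cong_ev[OF refl _ refl, THEN iffD1, OF _ deriv[of x s]])
        (use supp[OF _ that] in \<open>auto simp: eventually_nhds_metric dist_real_def intro!: exI[of _ 1]\<close>)
    then show ?thesis
      by (metis DERIV_const DERIV_unique)
  qed
  have "\<bar>v (s + h) x - v s x - h * g s x\<bar> \<le> e * \<bar>h\<bar>" if h: "\<bar>h\<bar> < min 1 d" for h x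
  proof (cases "norm x \<le> r")
    case False
    then show ?thesis
      using supp[of "s + h" x] supp[of s x] outside[of x] h \<open>e > 0\<close> by simp
  next
    case True
    have "norm (v (s + h) x - v s x - h * g s x) \<le> e * norm (s + h - s)"
    proof -
      have "norm ((v (s + h) x - (s + h) * g s x) - (v s x - s * g s x)) \<le> e * norm (s + h - s)"
      proof (rule field_differentiable_bound[of "closed_segment s (s + h)" _ "\<lambda>\<tau>. g \<tau> x - g s x"])
        fix \<tau> assume \<tau>: "\<tau> \<in> closed_segment s (s + h)"
        show "((\<lambda>\<tau>. v \<tau> x - \<tau> * g s x) has_field_derivative g \<tau> x - g s x) (at \<tau> within closed_segment s (s + h))"
          by (rule has_field_derivative_at_within) (auto intro!: derivative_eq_intros deriv)
        have "\<bar>\<tau> - s\<bar> < min 1 d"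
          using \<tau> h by (auto simp: closed_segment_eq_real_ivl split: if_splits)
        then show "norm (g \<tau> x - g s x) \<le> e"
          using near[OF _ True, of \<tau>] by simp
      qed auto
      then show ?thesis
        by (simp add: algebra_simps)
    qed
    then show ?thesis
      by simp
  qed
  then show ?thesis
    using d(1) by (intro exI[of _ "min 1 d"]) auto
qed

text \<open>
  Conditioning on time \<open>0\<close> and taking expectations removes the conditional expectation: what remains
  on the right is the kernel at the deterministic starting point.
\<close>

lemma law_from_deterministic_start:
  fixes X :: "real \<Rightarrow> 'w \<Rightarrow> 'a::euclidean_space"
  assumes X: "markov_process M X P" and P: "markov_kernels P"
    and start: "AE \<omega> in M. X 0 \<omega> = x" and "t \<ge> 0"
  shows "distr M borel (X t) = P t x"
proof -
  interpret prob_space M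
    using X by (simp add: markov_process_def)
  have meas [measurable]: "X r \<in> borel_measurable M" if "r \<ge> 0" for r
    using X that by (simp add: markov_process_def)
  define F where "F = natural_sigma M X 0"
  have gen: "{X r -` A \<inter> space M | r A. 0 \<le> r \<and> r \<le> 0 \<and> A \<in> sets borel} \<subseteq> sets M"
    using measurable_sets[OF meas] by auto
  have F: "space F = space M"
    "sets F = sigma_sets (space M) {X r -` A \<inter> space M | r A. 0 \<le> r \<and> r \<le> 0 \<and> A \<in> sets borel}"
    unfolding F_def natural_sigma_def using gen sets.space_closed[of M]
    by (auto simp: space_measure_of_conv intro!: sets_measure_of)
  have "subalgebra M F"
    using sets.sigma_sets_subset[OF gen] F by (simp add: subalgebra_def)
  then interpret finite_measure_subalgebra M F
    by unfold_locales
  have "P t \<in> borel \<rightarrow>\<^sub>M prob_algebra borel"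
    using P \<open>t \<ge> 0\<close> by (simp add: markov_kernels_def)
  then have "P t x \<in> space (prob_algebra borel)"
    by (auto dest: measurable_space)
  then have sets: "sets (P t x) = sets borel" and prob: "prob_space (P t x)"
    by (auto simp: space_prob_algebra)
  interpret P: prob_space "P t x"
    by (rule prob)
  show ?thesis
  proof (rule measure_eqI)
    fix A assume "A \<in> sets (distr M borel (X t))"
    then have A [measurable]: "A \<in> sets borel"
      by simp
    have Xt [measurable]: "X t \<in> borel_measurable M"
      by (rule meas[OF \<open>t \<ge> 0\<close>])
    interpret D: prob_space "distr M borel (X t)"
      by (rule prob_space_distr) simp
    have "AE \<omega> in M. real_cond_exp M F (\<lambda>\<omega>. indicator A (X (0 + t) \<omega>)) \<omega> = measure (P t (X 0 \<omega>)) A"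
      using X \<open>t \<ge> 0\<close> A unfolding markov_process_def F_def by blast
    with start have "AE \<omega> in M. real_cond_exp M F (\<lambda>\<omega>. indicator A (X t \<omega>)) \<omega> = measure (P t x) A"
      by eventually_elim simp
    then have "(LINT \<omega>|M. real_cond_exp M F (\<lambda>\<omega>. indicator A (X t \<omega>)) \<omega>) = (LINT \<omega>|M. measure (P t x) A)"
      by (intro integral_cong_AE) auto
    also have "\<dots> = measure (P t x) A"
      by (simp add: prob_space)
    also have "(LINT \<omega>|M. real_cond_exp M F (\<lambda>\<omega>. indicator A (X t \<omega>)) \<omega>) = (LINT \<omega>|M. indicator A (X t \<omega>))"
      by (intro real_cond_exp_int integrable_const_bound[where B=1]) auto
    also have "(LINT \<omega>|M. indicator A (X t \<omega>)) = measure (distr M borel (X t)) A"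
      using integral_distr[OF Xt, of "indicator A :: 'a \<Rightarrow> real"] by simp
    finally have "measure (distr M borel (X t)) A = measure (P t x) A" .
    then show "emeasure (distr M borel (X t)) A = emeasure (P t x) A"
      by (simp add: P.emeasure_eq_measure D.emeasure_eq_measure)
  qed (simp add: sets)
qed

section \<open>The generator on real functions\<close>

definition total_power :: "complex \<times> complex \<Rightarrow> real" where
  "total_power x = (cmod (fst x))\<^sup>2 + (cmod (snd x))\<^sup>2"

definition power_difference :: "complex \<times> complex \<Rightarrow> real" where
  "power_difference x = (cmod (fst x))\<^sup>2 - (cmod (snd x))\<^sup>2"

definition power_exchange :: "complex \<times> complex \<Rightarrow> real" where
  "power_exchange x = 2 * Im (fst x * cnj (snd x))"

text \<open>
  Derivatives at \<open>x\<close> in the direction \<open>h\<close>. Being polarisations of quadratic forms they are symmetric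
  and linear in \<open>h\<close> and \<open>x\<close>, so \<open>q' h k\<close> is at the same time the second derivative.
\<close>

definition total_power' :: "complex \<times> complex \<Rightarrow> complex \<times> complex \<Rightarrow> real" where
  "total_power' h x = 2 * (Re (fst x) * Re (fst h) + Im (fst x) * Im (fst h)
     + (Re (snd x) * Re (snd h) + Im (snd x) * Im (snd h)))"

definition power_difference' :: "complex \<times> complex \<Rightarrow> complex \<times> complex \<Rightarrow> real" where
  "power_difference' h x = 2 * (Re (fst x) * Re (fst h) + Im (fst x) * Im (fst h)
     - (Re (snd x) * Re (snd h) + Im (snd x) * Im (snd h)))"

definition power_exchange' :: "complex \<times> complex \<Rightarrow> complex \<times> complex \<Rightarrow> real" where
  "power_exchange' h x = 2 * (Im (fst x) * Re (snd h) + Im (fst h) * Re (snd x)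
     - (Re (fst x) * Im (snd h) + Re (fst h) * Im (snd x)))"

lemmas form_defs = total_power_def power_difference_def power_exchange_def
  total_power'_def power_difference'_def power_exchange'_def

lemma form_derivs [derivative_intros]:
  "(total_power has_derivative (\<lambda>h. total_power' h x)) (at x)"
  "(power_difference has_derivative (\<lambda>h. power_difference' h x)) (at x)"
  "(power_exchange has_derivative (\<lambda>h. power_exchange' h x)) (at x)"
  "(total_power' h has_derivative (\<lambda>k. total_power' h k)) (at x)"
  "(power_difference' h has_derivative (\<lambda>k. power_difference' h k)) (at x)"
  "(power_exchange' h has_derivative (\<lambda>k. power_exchange' h k)) (at x)"
  unfolding form_defs[abs_def] cmod_power2
  by (auto intro!: derivative_eq_intros simp: power2_eq_square algebra_simps)

lemma form_continuous [continuous_intros]: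
  "continuous_on A total_power" "continuous_on A power_difference" "continuous_on A power_exchange"
  "continuous_on A (total_power' h)" "continuous_on A (power_difference' h)"
  "continuous_on A (power_exchange' h)"
  unfolding form_defs[abs_def] by (intro continuous_intros)+

lemma total_power_norm: "total_power x = (norm x)\<^sup>2"
  by (simp add: total_power_def norm_prod_def)

definition has_two_derivatives ::
    "(complex \<times> complex \<Rightarrow> real) \<Rightarrow> (complex \<times> complex \<Rightarrow> complex \<times> complex \<Rightarrow> real)
      \<Rightarrow> (complex \<times> complex \<Rightarrow> complex \<times> complex \<Rightarrow> complex \<times> complex \<Rightarrow> real) \<Rightarrow> bool" where
  "has_two_derivatives F F1 F2 \<longleftrightarrow>
     (\<forall>x. (F has_derivative (\<lambda>h. F1 h x)) (at x)) \<and>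
     (\<forall>h x. (F1 h has_derivative (\<lambda>k. F2 h k x)) (at x))"

lemma dir_deriv_of_real:
  assumes "\<And>x. (F has_derivative (\<lambda>h. F1 h x)) (at x)"
  shows "dir_deriv h (\<lambda>x. complex_of_real (F x)) = (\<lambda>x. complex_of_real (F1 h x))"
proof
  fix x
  have "((\<lambda>x. complex_of_real (F x)) has_derivative (\<lambda>h. complex_of_real (F1 h x))) (at x)"
    by (intro derivative_intros assms)
  then show "dir_deriv h (\<lambda>x. complex_of_real (F x)) x = complex_of_real (F1 h x)"
    unfolding dir_deriv_def by (simp add: frechet_derivative_at[symmetric])
qed

text \<open>
  First Wirtinger derivatives of a real function have the shape \<open>(A + c B) / 2\<close> with \<open>c = \<plusminus> \<i>\<close>; this
  is the rule for differentiating them once more.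
\<close>

lemma dir_deriv_combination:
  assumes "\<And>x. (A has_derivative (\<lambda>h. A1 h x)) (at x)" "\<And>x. (B has_derivative (\<lambda>h. B1 h x)) (at x)"
  shows "dir_deriv h (\<lambda>x. (complex_of_real (A x) + c * complex_of_real (B x)) / 2)
    = (\<lambda>x. (complex_of_real (A1 h x) + c * complex_of_real (B1 h x)) / 2)"
proof
  fix x
  have "((\<lambda>x. (complex_of_real (A x) + c * complex_of_real (B x)) / 2)
      has_derivative (\<lambda>h. (complex_of_real (A1 h x) + c * complex_of_real (B1 h x)) / 2)) (at x)"
    by (auto intro!: derivative_eq_intros assms)
  then show "dir_deriv h (\<lambda>x. (complex_of_real (A x) + c * complex_of_real (B x)) / 2) x
    = (complex_of_real (A1 h x) + c * complex_of_real (B1 h x)) / 2"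
    unfolding dir_deriv_def by (simp add: frechet_derivative_at[symmetric])
qed

lemma two_derivatives_C2_compact:
  assumes D: "has_two_derivatives F F1 F2" and cont: "\<And>h k. continuous_on UNIV (F2 h k)"
    and supp: "\<And>x. norm x > r \<Longrightarrow> F x = 0"
  shows "(\<lambda>x. complex_of_real (F x)) \<in> C2_compact"
proof -
  have C1: "C1 (\<lambda>x. complex_of_real (A x))"
    if "\<And>x. (A has_derivative (\<lambda>h. A1 h x)) (at x)" "\<And>h. continuous_on UNIV (A1 h)" for A A1
  proof -
    have "((\<lambda>x. complex_of_real (A x)) has_derivative (\<lambda>h. complex_of_real (A1 h x))) (at x)" for x
      by (intro derivative_intros that)
    then show ?thesis
      unfolding C1_def dir_deriv_of_real[OF that(1)]
      by (auto simp: differentiable_def intro!: continuous_intros that(2))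
  qed
  have D1: "(F has_derivative (\<lambda>h. F1 h x)) (at x)" and D2: "(F1 h has_derivative (\<lambda>k. F2 h k x)) (at x)" for x h
    using D unfolding has_two_derivatives_def by blast+
  have cont1: "continuous_on UNIV (F1 h)" for h
    using has_derivative_continuous_on[of UNIV "F1 h"] D2 by (metis has_derivative_at_withinI)
  have "{x. F x \<noteq> 0} \<subseteq> cball 0 r"
    using supp by (auto simp: not_less[symmetric])
  then have "bounded {x. F x \<noteq> 0}"
    using bounded_cball bounded_subset by blast
  then have "compact (closure {x. complex_of_real (F x) \<noteq> 0})"
    by simp
  then show ?thesis
    unfolding C2_compact_def mem_Collect_eq dir_deriv_of_real[OF D1]
    using C1[OF D1 cont1] C1[OF D2 cont] by auto
qed

text \<open>
  In the real coordinates \<open>u = a + \<i> b\<close>, with \<open>e\<close> and \<open>h\<close> the directions of \<open>a\<close> and \<open>b\<close>, the factor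
  of \<open>\<Gamma>\<close> is the second power of the phase derivative \<open>a \<partial>\<^sub>b - b \<partial>\<^sub>a\<close>, while \<open>- \<Lambda> / 2\<close> multiplies the
  radial and \<open>K - \<Theta> / 2\<close> the phase derivative.
\<close>

lemma gen_single_of_real:
  assumes D: "has_two_derivatives F F1 F2" and sym: "\<And>h k x. F2 h k x = F2 k h x"
    and "h = cscale \<i> e"
  shows "gen_single \<Gamma> \<Lambda> \<Theta> K coord e (\<lambda>x. complex_of_real (F x)) x =
    complex_of_real (let a = Re (coord x); b = Im (coord x) in
      \<Gamma> * (a\<^sup>2 * F2 h h x + b\<^sup>2 * F2 e e x - 2 * a * b * F2 e h x - a * F1 e x - b * F1 h x)
      - \<Lambda> / 2 * (a * F1 e x + b * F1 h x) + (K - \<Theta> / 2) * (a * F1 h x - b * F1 e x))"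
proof -
  have D1: "(F has_derivative (\<lambda>h. F1 h x)) (at x)" and D2: "(F1 h has_derivative (\<lambda>k. F2 h k x)) (at x)" for x h
    using D unfolding has_two_derivatives_def by blast+
  have hol: "d_hol e (\<lambda>x. complex_of_real (F x)) = (\<lambda>x. (complex_of_real (F1 e x) + (- \<i>) * complex_of_real (F1 h x)) / 2)"
    and bar: "d_bar e (\<lambda>x. complex_of_real (F x)) = (\<lambda>x. (complex_of_real (F1 e x) + \<i> * complex_of_real (F1 h x)) / 2)"
    by (simp_all add: fun_eq_iff d_hol_def d_bar_def dir_deriv_of_real[OF D1] assms(3))
  obtain a b where ab: "coord x = Complex a b"
    by (cases "coord x")
  show ?thesis
    unfolding gen_single_def Let_def hol bar
    unfolding d_hol_def d_bar_def assms(3)[symmetric] dir_deriv_combination[OF D2 D2] ab sym[of h e]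
    by (simp add: complex_eq_iff power2_eq_square cmod_def field_simps)
qed

lemma gen_coupling_of_real:
  assumes "has_two_derivatives F F1 F2"
  shows "gen_coupling \<beta>' (\<lambda>x. complex_of_real (F x)) x =
    complex_of_real (\<beta>' * (Re (fst x) * F1 (0, \<i>) x - Im (fst x) * F1 (0, 1) x
      + Re (snd x) * F1 (\<i>, 0) x - Im (snd x) * F1 (1, 0) x))"
proof -
  have D1: "(F has_derivative (\<lambda>h. F1 h x)) (at x)" for x
    using assms unfolding has_two_derivatives_def by blast
  obtain a b c d where x: "x = (Complex a b, Complex c d)"
    by (metis complex.exhaust surj_pair)
  show ?thesis
    unfolding gen_coupling_def d_hol_def d_bar_def dir_deriv_of_real[OF D1] x
    by (simp add: complex_eq_iff cscale_def field_simps)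
qed

section \<open>Quadratic forms with a radial cutoff\<close>

text \<open>
  The quadratic forms themselves do not vanish at infinity. Multiplying by a function of the total
  power repairs this at little cost, since the generator acts on that factor through
  its radial part alone.
\<close>

locale radial_cutoff =
  fixes G G' G'' :: "real \<Rightarrow> real" and r :: real
  assumes G': "\<And>s. (G has_real_derivative G' s) (at s)"
    and G'': "\<And>s. (G' has_real_derivative G'' s) (at s)"
    and cont: "continuous_on UNIV G''"
    and support: "\<And>s. s > r \<Longrightarrow> G s = 0"
begin

definition test :: "real \<Rightarrow> real \<Rightarrow> real \<Rightarrow> real \<Rightarrow> complex \<times> complex \<Rightarrow> real" where
  "test c \<alpha> \<beta> \<sigma> x = (c + \<alpha> * power_difference x + \<beta> * power_exchange x) * G (\<sigma> * total_power x)"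

definition test_deriv where
  "test_deriv c \<alpha> \<beta> \<sigma> h x =
     (\<alpha> * power_difference' h x + \<beta> * power_exchange' h x) * G (\<sigma> * total_power x)
     + (c + \<alpha> * power_difference x + \<beta> * power_exchange x)
         * (G' (\<sigma> * total_power x) * (\<sigma> * total_power' h x))"

definition test_deriv2 where
  "test_deriv2 c \<alpha> \<beta> \<sigma> h k x =
     (\<alpha> * power_difference' h k + \<beta> * power_exchange' h k) * G (\<sigma> * total_power x)
     + (\<alpha> * power_difference' h x + \<beta> * power_exchange' h x)
         * (G' (\<sigma> * total_power x) * (\<sigma> * total_power' k x))
     + (\<alpha> * power_difference' k x + \<beta> * power_exchange' k x)
         * (G' (\<sigma> * total_power x) * (\<sigma> * total_power' h x))
     + (c + \<alpha> * power_difference x + \<beta> * power_exchange x)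
         * (G'' (\<sigma> * total_power x) * (\<sigma> * total_power' k x) * (\<sigma> * total_power' h x)
            + G' (\<sigma> * total_power x) * (\<sigma> * total_power' h k))"

lemma G_continuous:
  "continuous_on UNIV G" "continuous_on UNIV G'"
  using G' G'' by (auto intro!: DERIV_continuous_on simp: has_field_derivative_at_within)

lemma cutoff_derivs [derivative_intros]:
  "((\<lambda>x. G (\<sigma> * total_power x)) has_derivative
      (\<lambda>h. (\<sigma> * total_power' h x) * G' (\<sigma> * total_power x))) (at x)"
  "((\<lambda>x. G' (\<sigma> * total_power x)) has_derivative
      (\<lambda>h. (\<sigma> * total_power' h x) * G'' (\<sigma> * total_power x))) (at x)"
  by (rule DERIV_compose_FDERIV G' G'' derivative_intros)+

lemma test_derivatives: "has_two_derivatives (test c \<alpha> \<beta> \<sigma>) (test_deriv c \<alpha> \<beta> \<sigma>) (test_deriv2 c \<alpha> \<beta> \<sigma>)"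
  unfolding has_two_derivatives_def test_def[abs_def] test_deriv_def[abs_def] test_deriv2_def
  by (auto intro!: derivative_eq_intros simp: algebra_simps)

lemma test_deriv2_commute: "test_deriv2 c \<alpha> \<beta> \<sigma> h k x = test_deriv2 c \<alpha> \<beta> \<sigma> k h x"
  by (simp add: test_deriv2_def form_defs algebra_simps)

lemma test_C2_compact:
  assumes "\<sigma> > 0"
  shows "(\<lambda>x. complex_of_real (test c \<alpha> \<beta> \<sigma> x)) \<in> C2_compact"
proof (rule two_derivatives_C2_compact[OF test_derivatives])
  show "continuous_on UNIV (test_deriv2 c \<alpha> \<beta> \<sigma> h k)" for h k
    unfolding test_deriv2_def[abs_def]
    by (intro continuous_intros continuous_on_compose2[OF G_continuous(1)]
         continuous_on_compose2[OF G_continuous(2)] continuous_on_compose2[OF cont]) auto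
  show "test c \<alpha> \<beta> \<sigma> x = 0" if "norm x > sqrt (\<bar>r\<bar> / \<sigma>)" for x
  proof -
    have "(norm x)\<^sup>2 > \<bar>r\<bar> / \<sigma>"
      using that by (metis norm_ge_zero real_less_rsqrt not_le sqrt_le_D le_less_linear real_sqrt_le_iff real_sqrt_abs abs_norm_cancel)
    then have "\<sigma> * total_power x > r"
      using assms unfolding total_power_norm by (simp add: field_simps)
    then show ?thesis
      by (simp add: test_def support)
  qed
qed

text \<open>
  The three identities \<open>L S = - \<Lambda> S\<close>, \<open>L m = - \<Lambda> m + \<omega> w\<close>, \<open>L w = - \<Lambda> w - \<omega> m - 2\<Gamma> w\<close>, combined
  with the chain rule for the cutoff: no second derivative of \<open>G\<close> survives, because the
  second-order part differentiates along phases and the total power does not depend on them.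
\<close>

lemma weak_generator_test:
  fixes k n D \<theta> :: real
  defines "\<omega> \<equiv> 2 * \<theta> * mode_beta' k n D"
  shows "weak_generator k n D R \<theta> (\<lambda>x. complex_of_real (test c \<alpha> \<beta> \<sigma> x)) x =
    complex_of_real (
      ((- coef_Lambda k n D R * \<alpha> - \<omega> * \<beta>) * power_difference x
       + (\<omega> * \<alpha> - coef_Lambda k n D R * \<beta> - 2 * coef_Gamma k n D R * \<beta>) * power_exchange x)
        * G (\<sigma> * total_power x)
      + (c + \<alpha> * power_difference x + \<beta> * power_exchange x)
        * (G' (\<sigma> * total_power x) * (- coef_Lambda k n D R * \<sigma> * total_power x)))"
proof -
  obtain a b c' d where x: "x = (Complex a b, Complex c' d)"
    by (metis complex.exhaust surj_pair)
  have h: "(\<i>, 0) = cscale \<i> (1, 0)" "(0, \<i>) = cscale \<i> (0, 1)"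
    by (simp_all add: cscale_def)
  \<comment> \<open>Once the values of the cutoff are opaque, the claim is a polynomial identity in four real coordinates.\<close>
  define g0 g1 g2 where g_def: "g0 = G (\<sigma> * total_power x)" "g1 = G' (\<sigma> * total_power x)"
    "g2 = G'' (\<sigma> * total_power x)"
  show ?thesis
    unfolding weak_generator_def Let_def gen_coupling_of_real[OF test_derivatives]
      gen_single_of_real[OF test_derivatives test_deriv2_commute h(1)]
      gen_single_of_real[OF test_derivatives test_deriv2_commute h(2)]
    unfolding of_real_mult[symmetric] of_real_add[symmetric] of_real_eq_iff
    unfolding test_deriv_def test_deriv2_def g_def[symmetric]
    unfolding x form_defs cmod_power2 \<omega>_def
    by (simp, algebra)
qed

end

lemma positive_part_power_deriv:
  "((\<lambda>y::real. (max 0 y) ^ Suc (Suc m)) has_real_derivative real (Suc (Suc m)) * (max 0 y) ^ Suc m) (at y)"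
proof (cases y "0::real" rule: linorder_cases)
  case less
  have "((\<lambda>y. 0) has_real_derivative 0) (at y)"
    by simp
  then have "((\<lambda>y::real. (max 0 y) ^ Suc (Suc m)) has_real_derivative 0) (at y)"
    by (rule has_field_derivative_transform_within_open[of _ _ _ "{..<0}"]) (use less in auto)
  then show ?thesis
    using less by simp
next
  case greater
  have "((\<lambda>y. y ^ Suc (Suc m)) has_real_derivative real (Suc (Suc m)) * y ^ Suc m) (at y)"
    by (rule DERIV_cong[OF DERIV_pow]) simp
  then have "((\<lambda>y::real. (max 0 y) ^ Suc (Suc m)) has_real_derivative real (Suc (Suc m)) * y ^ Suc m) (at y)"
    by (rule has_field_derivative_transform_within_open[of _ _ _ "{0<..}"]) (use greater in auto)
  then show ?thesis
    using greater by simp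
next
  case equal
  have "((\<lambda>h::real. ((max 0 (0 + h)) ^ Suc (Suc m) - (max 0 0) ^ Suc (Suc m)) / h) \<longlongrightarrow> 0) (at 0)"
  proof (rule Lim_null_comparison)
    show "\<forall>\<^sub>F h in at 0. norm (((max 0 (0 + h)) ^ Suc (Suc m) - (max 0 0) ^ Suc (Suc m)) / h) \<le> \<bar>h::real\<bar> ^ Suc m"
    proof (intro always_eventually allI)
      fix h :: real
      show "norm (((max 0 (0 + h)) ^ Suc (Suc m) - (max 0 0) ^ Suc (Suc m)) / h) \<le> \<bar>h\<bar> ^ Suc m"
      proof (cases "h > 0")
        case False
        then have "max 0 (0 + h) = 0"
          by simp
        then show ?thesis
          by (simp del: power_Suc)
      qed (simp add: abs_mult)
    qed
    have "((\<lambda>h::real. \<bar>h\<bar> ^ Suc m) \<longlongrightarrow> \<bar>0\<bar> ^ Suc m) (at 0)"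
      by (intro tendsto_intros)
    then show "((\<lambda>h::real. \<bar>h\<bar> ^ Suc m) \<longlongrightarrow> 0) (at 0)"
      by simp
  qed
  then show ?thesis
    unfolding equal DERIV_def by simp
qed

text \<open>
  The third power of the positive part of a concave parabola is twice continuously differentiable.
\<close>

lemma peaked_cutoff_exists:
  fixes p :: real
  obtains G G' G'' where "radial_cutoff G G' G'' (p + 1)" "G p = 1"
    "\<And>s. 0 \<le> G s" "\<And>s. G s \<le> 1" "\<And>s. G s = 1 \<Longrightarrow> s = p"
proof -
  let ?b = "\<lambda>s. max 0 (1 - (s - p)\<^sup>2)"
  let ?G = "\<lambda>s. (?b s) ^ 3"
  let ?G' = "\<lambda>s. 3 * (?b s)\<^sup>2 * (- 2 * (s - p))"
  let ?G'' = "\<lambda>s. 6 * ?b s * (- 2 * (s - p))\<^sup>2 - 6 * (?b s)\<^sup>2"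
  have inner: "((\<lambda>s. 1 - (s - p)\<^sup>2) has_real_derivative - 2 * (s - p)) (at s)" for s
    by (auto intro!: derivative_eq_intros)
  have D3: "(?G has_real_derivative ?G' s) (at s)" for s
    using DERIV_chain2[OF positive_part_power_deriv[of 1] inner, of s]
    by (simp add: numeral_3_eq_3 numeral_2_eq_2)
  have D2: "((\<lambda>s. (?b s)\<^sup>2) has_real_derivative 2 * ?b s * (- 2 * (s - p))) (at s)" for s
    using DERIV_chain2[OF positive_part_power_deriv[of 0] inner, of s]
    by (simp add: numeral_2_eq_2)
  have cutoff: "radial_cutoff ?G ?G' ?G'' (p + 1)"
  proof
    show "(?G has_real_derivative ?G' s) (at s)" for s
      by (rule D3)
    show "(?G' has_real_derivative ?G'' s) (at s)" for s
      by (rule DERIV_cong[OF DERIV_mult[OF DERIV_cmult[OF D2, of 3]]])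
        (auto intro!: derivative_eq_intros simp: power2_eq_square algebra_simps)
    show "continuous_on UNIV ?G''"
      by (intro continuous_intros)
    show "?G s = 0" if "s > p + 1" for s
    proof -
      have "1 < (s - p)\<^sup>2"
        using that by (simp add: one_less_power)
      then show ?thesis
        by simp
    qed
  qed
  have range: "0 \<le> ?G s" "?G s \<le> 1" for s
    by (auto intro!: power_le_one)
  have unique: "s = p" if "?G s = 1" for s
  proof -
    have "?b s = 1"
      using power_eq_imp_eq_base[of "?b s" 3 1] that by simp
    then show ?thesis
      by (simp add: max_def split: if_splits)
  qed
  have peak: "?G p = 1"
    by simp
  show ?thesis
    by (rule that[OF cutoff peak range unique])
qed

text \<open>
  The rescaling \<open>\<sigma>\<close> inside \<open>G\<close> follows the radial contraction, and \<open>a\<close>, \<open>b\<close> solve the system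
  adjoint to the action of the generator on \<open>m\<close> and \<open>w\<close>; together they make the right-hand side a solution of the
  backward equation in \<open>t\<close>.
\<close>

lemma (in radial_cutoff) expectation_test:
  fixes P :: "real \<Rightarrow> complex \<times> complex \<Rightarrow> (complex \<times> complex) measure" and a b :: "real \<Rightarrow> real"
  assumes P: "feller P"
    and gen: "\<And>f. f \<in> C2_compact \<Longrightarrow> infinitesimal_generator P f (weak_generator k n D R \<theta> f)"
    and a: "\<And>z. (a has_real_derivative - (2 * \<theta> * mode_beta' k n D) * b z) (at z)"
    and b: "\<And>z. (b has_real_derivative
      2 * \<theta> * mode_beta' k n D * a z - 2 * coef_Gamma k n D R * b z) (at z)"
    and "t \<ge> 0"
  defines "\<sigma> \<equiv> \<lambda>z. exp (- coef_Lambda k n D R * z)"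
  shows "(LINT y|P t x. test c (a 0) (b 0) 1 y) = test c (\<sigma> t * a t) (\<sigma> t * b t) (\<sigma> t) x"
proof -
  interpret feller_semigroup P
    by unfold_locales (rule P)
  define \<Lambda> where "\<Lambda> = coef_Lambda k n D R"
  define \<omega> where "\<omega> = 2 * \<theta> * mode_beta' k n D"
  define \<Gamma> where "\<Gamma> = coef_Gamma k n D R"
  define v where "v z x = test c (\<sigma> z * a z) (\<sigma> z * b z) (\<sigma> z) x" for z x
  \<comment> \<open>This is both the image of \<open>v z\<close> under the generator and its derivative in \<open>z\<close>.\<close>
  define g where "g z x =
      ((- \<Lambda> * (\<sigma> z * a z) - \<omega> * (\<sigma> z * b z)) * power_difference x
       + (\<omega> * (\<sigma> z * a z) - \<Lambda> * (\<sigma> z * b z) - 2 * \<Gamma> * (\<sigma> z * b z)) * power_exchange x)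
        * G (\<sigma> z * total_power x)
      + (c + (\<sigma> z * a z) * power_difference x + (\<sigma> z * b z) * power_exchange x)
        * (G' (\<sigma> z * total_power x) * (- \<Lambda> * \<sigma> z * total_power x))" for z x
  have \<sigma>: "\<sigma> z > 0" "(\<sigma> has_real_derivative - \<Lambda> * \<sigma> z) (at z)" for z
    unfolding \<sigma>_def \<Lambda>_def by (auto intro!: derivative_eq_intros)
  have cont_coef: "continuous_on A \<sigma>" "continuous_on A a" "continuous_on A b" for A
    using DERIV_isCont[OF \<sigma>(2)] DERIV_isCont[OF a] DERIV_isCont[OF b]
    by (auto intro: continuous_at_imp_continuous_on)
  have "E t (v 0) x = v t x"
  proof (rule backward_equation_solution[OF _ _ \<open>t \<ge> 0\<close>])
    show "infinitesimal_generator P (\<lambda>x. complex_of_real (v s x)) (\<lambda>x. complex_of_real (g s x))" for s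
      using gen[OF test_C2_compact[OF \<sigma>(1)]]
      unfolding weak_generator_test v_def g_def \<Lambda>_def \<omega>_def \<Gamma>_def .
    show "\<exists>d>0. \<forall>h. \<bar>h\<bar> < d \<longrightarrow> (\<forall>x. \<bar>v (s + h) x - v s x - h * g s x\<bar> \<le> e * \<bar>h\<bar>)"
      if "e > 0" for s e
    proof (rule uniform_time_derivative[OF _ _ _ \<open>e > 0\<close>])
      have G_comp: "((\<lambda>s. G (\<sigma> s * total_power x)) has_real_derivative
          G' (\<sigma> s * total_power x) * (- \<Lambda> * \<sigma> s * total_power x)) (at s)" for s x
        by (rule DERIV_chain2[OF G']) (auto intro!: derivative_eq_intros \<sigma>)
      show "((\<lambda>s. v s x) has_real_derivative g s x) (at s)" for s x
      proof -
        have "((\<lambda>s. c + \<sigma> s * a s * power_difference x + \<sigma> s * b s * power_exchange x) has_real_derivative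
            (- \<Lambda> * (\<sigma> s * a s) - \<omega> * (\<sigma> s * b s)) * power_difference x
            + (\<omega> * (\<sigma> s * a s) - \<Lambda> * (\<sigma> s * b s) - 2 * \<Gamma> * (\<sigma> s * b s)) * power_exchange x) (at s)"
          by (auto intro!: derivative_eq_intros \<sigma> a b simp: \<omega>_def \<Gamma>_def algebra_simps)
        from DERIV_mult[OF this G_comp[of x s]] show ?thesis
          unfolding v_def g_def test_def by (simp add: algebra_simps)
      qed
      have comps: "continuous_on UNIV (\<lambda>p. \<sigma> (fst p))" "continuous_on UNIV (\<lambda>p. a (fst p))"
        "continuous_on UNIV (\<lambda>p. b (fst p))" "continuous_on UNIV (\<lambda>p. total_power (snd p))"
        "continuous_on UNIV (\<lambda>p. power_difference (snd p))"
        "continuous_on UNIV (\<lambda>p. power_exchange (snd p))"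
        by (rule continuous_on_compose2[OF _ continuous_on_fst[OF continuous_on_id], of UNIV]
              continuous_on_compose2[OF _ continuous_on_snd[OF continuous_on_id], of UNIV],
            rule cont_coef form_continuous, simp)+
      have cutoffs: "continuous_on UNIV (\<lambda>p. G (\<sigma> (fst p) * total_power (snd p)))"
        "continuous_on UNIV (\<lambda>p. G' (\<sigma> (fst p) * total_power (snd p)))"
        by (rule continuous_on_compose2[OF G_continuous(1)] continuous_on_compose2[OF G_continuous(2)],
            intro continuous_on_mult comps, simp)+
      have "continuous_on UNIV (\<lambda>p. g (fst p) (snd p))"
        unfolding g_def
        by (intro continuous_on_add continuous_on_diff continuous_on_mult continuous_on_const comps cutoffs)
      then show "continuous_on UNIV (\<lambda>(s, x). g s x)"
        by (simp add: case_prod_beta)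
      show "v \<tau> x = 0" if \<tau>: "\<bar>\<tau> - s\<bar> \<le> 1" and x: "norm x > sqrt (\<bar>r\<bar> / exp (- \<Lambda> * s - \<bar>\<Lambda>\<bar>))" for \<tau> x
      proof -
        \<comment> \<open>The support must be bounded uniformly for times near \<open>s\<close>, whatever the sign of \<open>\<Lambda>\<close>.\<close>
        have "\<Lambda> * (\<tau> - s) \<le> \<bar>\<Lambda>\<bar>"
        proof -
          have "\<Lambda> * (\<tau> - s) \<le> \<bar>\<Lambda>\<bar> * \<bar>\<tau> - s\<bar>"
            by (metis abs_ge_self abs_mult)
          also have "\<dots> \<le> \<bar>\<Lambda>\<bar>"
            using \<tau> by (simp add: mult_left_le)
          finally show ?thesis .
        qed
        then have "exp (- \<Lambda> * s - \<bar>\<Lambda>\<bar>) \<le> \<sigma> \<tau>"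
          unfolding \<sigma>_def \<Lambda>_def[symmetric] by (simp add: algebra_simps)
        then have "\<sigma> \<tau> * total_power x \<ge> exp (- \<Lambda> * s - \<bar>\<Lambda>\<bar>) * total_power x"
          by (intro mult_right_mono) (auto simp: total_power_def)
        moreover have "(norm x)\<^sup>2 > \<bar>r\<bar> / exp (- \<Lambda> * s - \<bar>\<Lambda>\<bar>)"
          using x by (metis norm_ge_zero not_le real_sqrt_abs abs_norm_cancel real_sqrt_le_iff)
        then have "exp (- \<Lambda> * s - \<bar>\<Lambda>\<bar>) * total_power x > r"
          unfolding total_power_norm by (simp add: field_simps)
        ultimately show ?thesis
          by (simp add: v_def test_def support)
      qed
    qed
  qed
  then show ?thesis
    by (simp add: E_def v_def \<sigma>_def)
qed

section \<open>Mode parameters and the damped oscillator\<close>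

text \<open>
  As \<open>\<beta>\<close> increases from \<open>k\<close> to \<open>n k\<close>, \<open>\<xi> tan (D \<xi> / 2)\<close> decreases to \<open>0\<close> while \<open>\<eta>\<close>
  increases from \<open>0\<close>, so the two cross exactly once. The single-mode condition keeps the argument
  of the tangent below \<open>\<pi> / 2\<close>.
\<close>

lemma mode_beta_bounds:
  assumes "k > 0" "D > 0" "n > 1" and mono_mode: "k * D * sqrt (n\<^sup>2 - 1) < pi"
  shows "k < mode_beta k n D \<and> mode_beta k n D < n * k"
proof -
  define \<xi> where "\<xi> \<beta> = sqrt (n\<^sup>2 * k\<^sup>2 - \<beta>\<^sup>2)" for \<beta>
  define \<eta> where "\<eta> \<beta> = sqrt (\<beta>\<^sup>2 - k\<^sup>2)" for \<beta>
  have "k < n * k"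
    using assms by simp
  have \<xi>_range: "0 \<le> D / 2 * \<xi> \<beta>" "D / 2 * \<xi> \<beta> < pi / 2" if "k \<le> \<beta>" "\<beta> \<le> n * k" for \<beta>
  proof -
    have "k\<^sup>2 \<le> \<beta>\<^sup>2" "\<beta>\<^sup>2 \<le> (n * k)\<^sup>2"
      using that \<open>k > 0\<close> by (auto intro!: power_mono)
    then show "0 \<le> D / 2 * \<xi> \<beta>"
      using \<open>D > 0\<close> by (simp add: \<xi>_def power_mult_distrib)
    have "\<xi> \<beta> \<le> sqrt (k\<^sup>2 * (n\<^sup>2 - 1))"
      using \<open>k\<^sup>2 \<le> \<beta>\<^sup>2\<close> unfolding \<xi>_def by (intro real_sqrt_le_mono) (simp add: algebra_simps)
    also have "\<dots> = k * sqrt (n\<^sup>2 - 1)"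
      using \<open>k > 0\<close> by (simp add: real_sqrt_mult)
    finally have "D * \<xi> \<beta> \<le> D * (k * sqrt (n\<^sup>2 - 1))"
      using \<open>D > 0\<close> by simp
    then show "D / 2 * \<xi> \<beta> < pi / 2"
      using mono_mode by (simp add: mult.commute mult.left_commute)
  qed
  have \<eta>_pos: "\<eta> \<beta> > 0" if "k < \<beta>" for \<beta>
    using that \<open>k > 0\<close> by (simp add: \<eta>_def power_strict_mono)
  have dispersion: "\<xi> \<beta> / \<eta> \<beta> * tan (D / 2 * \<xi> \<beta>) = 1 \<longleftrightarrow> \<xi> \<beta> * tan (D / 2 * \<xi> \<beta>) - \<eta> \<beta> = 0"
    if "k < \<beta>" for \<beta>
    using \<eta>_pos[OF that] by (auto simp: field_simps)
  have cont: "continuous_on {k..n * k} (\<lambda>\<beta>. \<xi> \<beta> * tan (D / 2 * \<xi> \<beta>) - \<eta> \<beta>)"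
  proof -
    have "cos (D / 2 * \<xi> \<beta>) \<noteq> 0" if "\<beta> \<in> {k..n * k}" for \<beta>
      using \<xi>_range[of \<beta>] that cos_gt_zero_pi[of "D / 2 * \<xi> \<beta>"] by auto
    then show ?thesis
      unfolding \<xi>_def \<eta>_def by (intro continuous_intros) auto
  qed
  have "\<xi> k * tan (D / 2 * \<xi> k) - \<eta> k > 0"
  proof -
    have "1 < n\<^sup>2"
      using assms(3) by (simp add: one_less_power)
    then have "\<xi> k > 0"
      using assms by (simp add: \<xi>_def)
    moreover have "tan (D / 2 * \<xi> k) > 0"
      using \<xi>_range[of k] \<open>k < n * k\<close> \<open>\<xi> k > 0\<close> \<open>D > 0\<close> by (intro tan_gt_zero) auto
    ultimately show ?thesis
      by (simp add: \<eta>_def)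
  qed
  moreover have "\<xi> (n * k) * tan (D / 2 * \<xi> (n * k)) - \<eta> (n * k) < 0"
    using \<eta>_pos[OF \<open>k < n * k\<close>] by (simp add: \<xi>_def power_mult_distrib)
  ultimately obtain \<beta> where \<beta>: "k \<le> \<beta>" "\<beta> \<le> n * k" "\<xi> \<beta> * tan (D / 2 * \<xi> \<beta>) - \<eta> \<beta> = 0"
    using IVT2'[of "\<lambda>\<beta>. \<xi> \<beta> * tan (D / 2 * \<xi> \<beta>) - \<eta> \<beta>" "n * k" 0 k] cont \<open>k < n * k\<close> by force
  have "\<beta> \<noteq> k" "\<beta> \<noteq> n * k"
    using \<beta>(3) \<open>\<xi> k * tan (D / 2 * \<xi> k) - \<eta> k > 0\<close>
      \<open>\<xi> (n * k) * tan (D / 2 * \<xi> (n * k)) - \<eta> (n * k) < 0\<close> by auto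
  then have root: "k < \<beta> \<and> \<beta> < n * k \<and> \<xi> \<beta> / \<eta> \<beta> * tan (D / 2 * \<xi> \<beta>) = 1"
    using \<beta> dispersion[of \<beta>] by auto
  have no_two_roots: "\<not> \<beta>1 < \<beta>2"
    if "k < \<beta>1" "\<beta>2 < n * k" "\<xi> \<beta>1 * tan (D / 2 * \<xi> \<beta>1) - \<eta> \<beta>1 = 0"
      "\<xi> \<beta>2 * tan (D / 2 * \<xi> \<beta>2) - \<eta> \<beta>2 = 0" for \<beta>1 \<beta>2
  proof
    assume "\<beta>1 < \<beta>2"
    then have "\<beta>1\<^sup>2 < \<beta>2\<^sup>2"
      using that \<open>k > 0\<close> by (intro power_strict_mono) auto
    then have \<xi>: "\<xi> \<beta>2 \<le> \<xi> \<beta>1" and \<eta>: "\<eta> \<beta>1 < \<eta> \<beta>2"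
      by (auto simp: \<xi>_def \<eta>_def)
    have "D / 2 * \<xi> \<beta>2 \<le> D / 2 * \<xi> \<beta>1"
      using \<xi> \<open>D > 0\<close> by simp
    moreover have "0 \<le> D / 2 * \<xi> \<beta>2" "D / 2 * \<xi> \<beta>1 < pi / 2"
      using \<xi>_range that \<open>\<beta>1 < \<beta>2\<close> by auto
    ultimately have "tan (D / 2 * \<xi> \<beta>2) \<le> tan (D / 2 * \<xi> \<beta>1)" "0 \<le> tan (D / 2 * \<xi> \<beta>2)"
      by (auto intro!: tan_mono_le simp: tan_pos_pi2_le)
    then have "\<xi> \<beta>2 * tan (D / 2 * \<xi> \<beta>2) \<le> \<xi> \<beta>1 * tan (D / 2 * \<xi> \<beta>1)"
      using \<xi> \<xi>_range(1)[of \<beta>1] that \<open>\<beta>1 < \<beta>2\<close> \<open>D > 0\<close>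
      by (intro mult_mono) (auto simp: zero_le_mult_iff)
    then show False
      using that \<eta> by simp
  qed
  have "\<exists>!\<beta>. k < \<beta> \<and> \<beta> < n * k \<and> \<xi> \<beta> / \<eta> \<beta> * tan (D / 2 * \<xi> \<beta>) = 1"
  proof (rule ex_ex1I)
    fix \<beta>1 \<beta>2
    assume 1: "k < \<beta>1 \<and> \<beta>1 < n * k \<and> \<xi> \<beta>1 / \<eta> \<beta>1 * tan (D / 2 * \<xi> \<beta>1) = 1"
      and 2: "k < \<beta>2 \<and> \<beta>2 < n * k \<and> \<xi> \<beta>2 / \<eta> \<beta>2 * tan (D / 2 * \<xi> \<beta>2) = 1"
    show "\<beta>1 = \<beta>2"
      using 1 2 no_two_roots[of \<beta>1 \<beta>2] no_two_roots[of \<beta>2 \<beta>1] dispersion by (metis linorder_less_linear)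
  qed (use root in blast)
  from theI'[OF this] show ?thesis
    unfolding mode_beta_def \<xi>_def \<eta>_def by blast
qed

lemma mode_beta'_nonneg:
  assumes "k > 0" "D > 0" "n > 1" "k * D * sqrt (n\<^sup>2 - 1) < pi"
  shows "mode_beta' k n D \<ge> 0"
proof -
  have *: "k < mode_beta k n D"
    using mode_beta_bounds[OF assms] by simp
  then have "mode_eta k n D \<ge> 0"
    using assms(1) by (simp add: mode_eta_def power_mono)
  then show ?thesis
    using * assms unfolding mode_beta'_def Let_def
    by (intro divide_nonneg_nonneg mult_nonneg_nonneg add_nonneg_nonneg) auto
qed

lemma coef_Gamma_nonneg:
  assumes "\<And>q. cov_hat R q \<in> \<real>\<^sub>\<ge>\<^sub>0"
  shows "coef_Gamma k n D R \<ge> 0"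
proof -
  have "Re (cov_hat R 0) \<ge> 0"
    using assms[of 0] by (auto elim: nonneg_Reals_cases)
  then show ?thesis
    unfolding coef_Gamma_def by simp
qed

text \<open>
  From the response \<open>s\<close> to a unit impulse, \<open>s' + 2\<Gamma> s\<close> is the solution with value \<open>1\<close> and slope \<open>0\<close>
  at the origin. Together with \<open>\<omega> s\<close> it solves the first-order system for the coefficients of \<open>m\<close> and
  \<open>w\<close>, also when \<open>\<omega> = 0\<close>, where that system cannot be recovered from the second-order equation.
\<close>

lemma damped_oscillator_impulse_response:
  fixes \<Gamma> \<omega> :: real
  assumes "\<omega> \<ge> 0" "\<Gamma> \<ge> 0"
  obtains s s' where
    "\<And>z. (s has_real_derivative s' z) (at z)"
    "\<And>z. (s' has_real_derivative - 2 * \<Gamma> * s' z - \<omega>\<^sup>2 * s z) (at z)"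
    "s 0 = 0" "s' 0 = 1"
    "\<And>z. s' z + 2 * \<Gamma> * s z =
      (if \<omega> < \<Gamma> then
         exp (- \<Gamma> * z) * (cosh (sqrt (\<Gamma>\<^sup>2 - \<omega>\<^sup>2) * z)
           + \<Gamma> / sqrt (\<Gamma>\<^sup>2 - \<omega>\<^sup>2) * sinh (sqrt (\<Gamma>\<^sup>2 - \<omega>\<^sup>2) * z))
       else if \<omega> = \<Gamma> then (1 + \<Gamma> * z) * exp (- \<Gamma> * z)
       else
         exp (- \<Gamma> * z) * (cos (sqrt (\<omega>\<^sup>2 - \<Gamma>\<^sup>2) * z)
           + \<Gamma> / sqrt (\<omega>\<^sup>2 - \<Gamma>\<^sup>2) * sin (sqrt (\<omega>\<^sup>2 - \<Gamma>\<^sup>2) * z)))"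
proof (cases \<omega> \<Gamma> rule: linorder_cases)
  case less
  define \<delta> where "\<delta> = sqrt (\<Gamma>\<^sup>2 - \<omega>\<^sup>2)"
  have "\<omega>\<^sup>2 < \<Gamma>\<^sup>2"
    using less assms by (simp add: power_strict_mono)
  then have \<delta>: "\<delta> > 0" "\<omega>\<^sup>2 = \<Gamma>\<^sup>2 - \<delta>\<^sup>2"
    by (auto simp: \<delta>_def)
  show ?thesis
  proof
    let ?s = "\<lambda>z. exp (- \<Gamma> * z) * (sinh (\<delta> * z) / \<delta>)"
    let ?s' = "\<lambda>z. exp (- \<Gamma> * z) * (cosh (\<delta> * z) - \<Gamma> / \<delta> * sinh (\<delta> * z))"
    show "(?s has_real_derivative ?s' z) (at z)" for z
      using \<delta>(1) by (auto intro!: derivative_eq_intros simp: field_simps)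
    show "(?s' has_real_derivative - 2 * \<Gamma> * ?s' z - \<omega>\<^sup>2 * ?s z) (at z)" for z
      unfolding \<delta>(2) using \<delta>(1)
      by (auto intro!: derivative_eq_intros simp: field_simps power2_eq_square)
    show "?s' z + 2 * \<Gamma> * ?s z =
      (if \<omega> < \<Gamma> then
         exp (- \<Gamma> * z) * (cosh (sqrt (\<Gamma>\<^sup>2 - \<omega>\<^sup>2) * z)
           + \<Gamma> / sqrt (\<Gamma>\<^sup>2 - \<omega>\<^sup>2) * sinh (sqrt (\<Gamma>\<^sup>2 - \<omega>\<^sup>2) * z))
       else if \<omega> = \<Gamma> then (1 + \<Gamma> * z) * exp (- \<Gamma> * z)
       else
         exp (- \<Gamma> * z) * (cos (sqrt (\<omega>\<^sup>2 - \<Gamma>\<^sup>2) * z)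
           + \<Gamma> / sqrt (\<omega>\<^sup>2 - \<Gamma>\<^sup>2) * sin (sqrt (\<omega>\<^sup>2 - \<Gamma>\<^sup>2) * z)))" for z
      using less \<delta>(1) unfolding \<delta>_def[symmetric] by (simp add: field_simps)
  qed auto
next
  case equal
  show ?thesis
  proof
    let ?s = "\<lambda>z. z * exp (- \<Gamma> * z)"
    let ?s' = "\<lambda>z. (1 - \<Gamma> * z) * exp (- \<Gamma> * z)"
    show "(?s has_real_derivative ?s' z) (at z)" for z
      by (auto intro!: derivative_eq_intros simp: algebra_simps)
    show "(?s' has_real_derivative - 2 * \<Gamma> * ?s' z - \<omega>\<^sup>2 * ?s z) (at z)" for z
      using equal by (auto intro!: derivative_eq_intros simp: algebra_simps power2_eq_square)
  qed (use equal in \<open>auto simp: algebra_simps\<close>)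
next
  case greater
  define \<delta> where "\<delta> = sqrt (\<omega>\<^sup>2 - \<Gamma>\<^sup>2)"
  have "\<Gamma>\<^sup>2 < \<omega>\<^sup>2"
    using greater \<open>\<Gamma> \<ge> 0\<close> by (simp add: power_strict_mono)
  then have \<delta>: "\<delta> > 0" "\<omega>\<^sup>2 = \<Gamma>\<^sup>2 + \<delta>\<^sup>2"
    by (auto simp: \<delta>_def)
  show ?thesis
  proof
    let ?s = "\<lambda>z. exp (- \<Gamma> * z) * (sin (\<delta> * z) / \<delta>)"
    let ?s' = "\<lambda>z. exp (- \<Gamma> * z) * (cos (\<delta> * z) - \<Gamma> / \<delta> * sin (\<delta> * z))"
    show "(?s has_real_derivative ?s' z) (at z)" for z
      using \<delta>(1) by (auto intro!: derivative_eq_intros simp: field_simps)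
    show "(?s' has_real_derivative - 2 * \<Gamma> * ?s' z - \<omega>\<^sup>2 * ?s z) (at z)" for z
      unfolding \<delta>(2) using \<delta>(1)
      by (auto intro!: derivative_eq_intros simp: field_simps power2_eq_square)
    show "?s' z + 2 * \<Gamma> * ?s z =
      (if \<omega> < \<Gamma> then
         exp (- \<Gamma> * z) * (cosh (sqrt (\<Gamma>\<^sup>2 - \<omega>\<^sup>2) * z)
           + \<Gamma> / sqrt (\<Gamma>\<^sup>2 - \<omega>\<^sup>2) * sinh (sqrt (\<Gamma>\<^sup>2 - \<omega>\<^sup>2) * z))
       else if \<omega> = \<Gamma> then (1 + \<Gamma> * z) * exp (- \<Gamma> * z)
       else
         exp (- \<Gamma> * z) * (cos (sqrt (\<omega>\<^sup>2 - \<Gamma>\<^sup>2) * z)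
           + \<Gamma> / sqrt (\<omega>\<^sup>2 - \<Gamma>\<^sup>2) * sin (sqrt (\<omega>\<^sup>2 - \<Gamma>\<^sup>2) * z)))" for z
      using greater \<delta>(1) unfolding \<delta>_def[symmetric] by (simp add: field_simps)
  qed auto
qed

section \<open>Power decay and power imbalance\<close>

text \<open>
  An almost sure identity at each fixed time holds simultaneously at all rational times; a
  discrepancy at a single time would persist, by right-continuity, on an interval to its right.
\<close>

lemma AE_all_times_from_rational_times:
  fixes X :: "real \<Rightarrow> 'w \<Rightarrow> 'a::topological_space" and f :: "'a \<Rightarrow> real"
  assumes fixed: "\<And>t. t \<ge> 0 \<Longrightarrow> AE \<omega> in M. f (X t \<omega>) = g t"
    and paths: "AE \<omega> in M. \<forall>t\<ge>0. continuous (at_right t) (\<lambda>s. X s \<omega>)"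
    and f: "continuous_on UNIV f" and g: "continuous_on UNIV g"
  shows "AE \<omega> in M. \<forall>t\<ge>0. f (X t \<omega>) = g t"
proof -
  have "AE \<omega> in M. \<forall>q\<in>\<rat> \<inter> {0..}. f (X q \<omega>) = g q"
    by (rule AE_ball_countable') (auto intro: fixed countable_Int1 countable_rat)
  with paths show ?thesis
  proof eventually_elim
    case (elim \<omega>)
    show ?case
    proof (intro allI impI, rule ccontr)
      fix t :: real assume "t \<ge> 0" and ne: "f (X t \<omega>) \<noteq> g t"
      have "((\<lambda>s. X s \<omega>) \<longlongrightarrow> X t \<omega>) (at_right t)"
        using elim(1) \<open>t \<ge> 0\<close> by (simp add: continuous_within)
      then have "((\<lambda>s. f (X s \<omega>)) \<longlongrightarrow> f (X t \<omega>)) (at_right t)"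
        by (rule continuous_on_tendsto_compose[OF f]) auto
      moreover have "(g \<longlongrightarrow> g t) (at_right t)"
        using g by (metis continuous_on_def UNIV_I tendsto_within_subset subset_UNIV)
      ultimately have "((\<lambda>s. f (X s \<omega>) - g s) \<longlongrightarrow> f (X t \<omega>) - g t) (at_right t)"
        by (rule tendsto_diff)
      then have "\<forall>\<^sub>F s in at_right t. f (X s \<omega>) - g s \<noteq> 0"
        by (rule tendsto_imp_eventually_ne) (use ne in simp)
      then obtain u where "u > t" "\<And>s. t < s \<Longrightarrow> s < u \<Longrightarrow> f (X s \<omega>) \<noteq> g s"
        unfolding eventually_at_right_field by auto
      moreover obtain q where "q \<in> \<rat>" "t < q" "q < u"
        using Rats_dense_in_real[OF \<open>u > t\<close>] by blast
      ultimately show False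
        using elim(2) \<open>t \<ge> 0\<close> by force
    qed
  qed
qed

theorem mainTheorem7:
  fixes k n D \<theta> :: real
    and R :: "real \<Rightarrow> real"
    and N :: "'b measure" and \<nu> :: "real \<Rightarrow> 'b \<Rightarrow> real"
    and M :: "'w measure" and up um :: "real \<Rightarrow> 'w \<Rightarrow> complex"
    and ae ao :: complex
  defines "\<Gamma> \<equiv> coef_Gamma k n D R"
    and "\<Lambda> \<equiv> coef_Lambda k n D R"
    and "\<omega>0 \<equiv> 2 * \<theta> * mode_beta' k n D"
    and "EP \<equiv> \<lambda>z. LINT \<omega>|M. power_imbalance up um z \<omega>"
  assumes "k > 0" and "D > 0" and "n > 1" and "k * D * sqrt (n\<^sup>2 - 1) < pi"
    and "\<theta> \<ge> 0"
    and "stationary_with_covariance N \<nu> R" and "smooth_real R" and "integrable lborel R"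
    and "\<And>q. cov_hat R q \<in> \<real>\<^sub>\<ge>\<^sub>0"
    and "(ae, ao) \<noteq> (0, 0)"
    and "markov_process_with_generator M (\<lambda>z \<omega>. (up z \<omega>, um z \<omega>)) (weak_generator k n D R \<theta>)"
    and "AE \<omega> in M. up 0 \<omega> = ae + ao \<and> um 0 \<omega> = ae - ao"
  shows "(AE \<omega> in M. \<forall>z\<ge>0.
            (cmod (up z \<omega>))\<^sup>2 + (cmod (um z \<omega>))\<^sup>2
              = 2 * ((cmod ae)\<^sup>2 + (cmod ao)\<^sup>2) * exp (- \<Lambda> * z)) \<and>
         (\<exists>EP' EP''. \<forall>z\<ge>0.
            (EP has_real_derivative EP' z) (at z within {0..}) \<and>
            (EP' has_real_derivative EP'' z) (at z within {0..}) \<and>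
            EP'' z + 2 * \<Gamma> * EP' z + \<omega>0\<^sup>2 * EP z = 0) \<and>
         (ae = ao \<longrightarrow>
            (AE \<omega> in M. um 0 \<omega> = 0 \<and> power_imbalance up um 0 \<omega> = 1) \<and>
            (\<forall>z\<ge>0. EP z =
              (if \<omega>0 < \<Gamma> then
                 exp (- \<Gamma> * z) * (cosh (sqrt (\<Gamma>\<^sup>2 - \<omega>0\<^sup>2) * z)
                   + \<Gamma> / sqrt (\<Gamma>\<^sup>2 - \<omega>0\<^sup>2) * sinh (sqrt (\<Gamma>\<^sup>2 - \<omega>0\<^sup>2) * z))
               else if \<omega>0 = \<Gamma> then (1 + \<Gamma> * z) * exp (- \<Gamma> * z)
               else
                 exp (- \<Gamma> * z) * (cos (sqrt (\<omega>0\<^sup>2 - \<Gamma>\<^sup>2) * z)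
                   + \<Gamma> / sqrt (\<omega>0\<^sup>2 - \<Gamma>\<^sup>2) * sin (sqrt (\<omega>0\<^sup>2 - \<Gamma>\<^sup>2) * z)))))"
proof (intro conjI impI)
  let ?X = "\<lambda>z \<omega>. (up z \<omega>, um z \<omega>)"
  obtain P where P: "feller P" and X: "markov_process M ?X P"
    and gen: "\<And>f. f \<in> C2_compact \<Longrightarrow> infinitesimal_generator P f (weak_generator k n D R \<theta> f)"
    and paths: "AE \<omega> in M. \<forall>t\<ge>0. continuous (at_right t) (\<lambda>s. ?X s \<omega>)"
    using assms(15) unfolding markov_process_with_generator_def by blast
  interpret prob_space M
    using X by (simp add: markov_process_def)
  have X_meas [measurable]: "?X t \<in> borel_measurable M" if "t \<ge> 0" for t
    using X that by (simp add: markov_process_def)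
  define x where "x = (ae + ao, ae - ao)"
  define S where "S = total_power x"
  have S_eq: "S = 2 * ((cmod ae)\<^sup>2 + (cmod ao)\<^sup>2)"
    unfolding S_def x_def total_power_def cmod_power2 by (simp add: power2_eq_square algebra_simps)
  have "S > 0"
    using assms(14) by (auto simp: S_eq intro: add_pos_nonneg add_nonneg_pos)
  have "AE \<omega> in M. ?X 0 \<omega> = x"
    using assms(16) by (auto simp: x_def)
  then have law: "distr M borel (?X t) = P t x" if "t \<ge> 0" for t
    using law_from_deterministic_start[OF X _ _ that] P by (simp add: feller_def)
  have \<Gamma>: "\<Gamma> \<ge> 0"
    unfolding \<Gamma>_def by (rule coef_Gamma_nonneg[OF assms(13)])
  have \<omega>0: "\<omega>0 \<ge> 0"
    unfolding \<omega>0_def using mode_beta'_nonneg[OF assms(5-8)] assms(9) by simp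
  define \<sigma> where "\<sigma> z = exp (- \<Lambda> * z)" for z
  have \<sigma>: "\<sigma> z > 0" for z
    by (simp add: \<sigma>_def)

  have integral_X: "(LINT \<omega>|M. f (?X t \<omega>)) = (LINT y|P t x. f y)"
    if "t \<ge> 0" "f \<in> borel_measurable borel" for t and f :: "complex \<times> complex \<Rightarrow> real"
    using integral_distr[OF X_meas[OF that(1)] that(2)] law[OF that(1)] by simp
  have S_fixed: "AE \<omega> in M. total_power (?X t \<omega>) = \<sigma> t * S" if "t \<ge> 0" for t
  proof -
    \<comment> \<open>The peak is put at the predicted value of the total power.\<close>
    obtain G G' G'' where cutoff: "radial_cutoff G G' G'' (\<sigma> t * S + 1)" and peak: "G (\<sigma> t * S) = 1"
      and G: "\<And>s. 0 \<le> G s" "\<And>s. G s \<le> 1" "\<And>s. G s = 1 \<Longrightarrow> s = \<sigma> t * S"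
      by (rule peaked_cutoff_exists[of "\<sigma> t * S"]) blast
    interpret radial_cutoff G G' G'' "\<sigma> t * S + 1"
      by (rule cutoff)
    have test: "test 1 0 0 \<tau> = (\<lambda>y. G (\<tau> * total_power y))" for \<tau>
      by (simp add: test_def fun_eq_iff)
    have meas: "(\<lambda>y. G (total_power y)) \<in> borel_measurable borel"
      by (intro borel_measurable_continuous_onI continuous_on_compose2[OF G_continuous(1)]
          continuous_intros) auto
    have [measurable]: "(\<lambda>\<omega>. G (total_power (?X t \<omega>))) \<in> borel_measurable M"
      using measurable_compose[OF X_meas[OF that] meas] .
    have int: "integrable M (\<lambda>\<omega>. G (total_power (?X t \<omega>)))"
      by (rule integrable_const_bound[where B=1]) (use G in auto)
    have "(LINT \<omega>|M. G (total_power (?X t \<omega>))) = G (\<sigma> t * S)"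
      using expectation_test[OF P gen, where a="\<lambda>_. 0" and b="\<lambda>_. 0" and t=t and c=1 and x=x] that
      unfolding integral_X[OF that meas]
      by (simp add: test S_def \<sigma>_def \<Lambda>_def)
    then have "(LINT \<omega>|M. 1 - G (total_power (?X t \<omega>))) = 0"
      using int peak by (simp add: prob_space)
    then have "AE \<omega> in M. 1 - G (total_power (?X t \<omega>)) = 0"
      using G int by (subst (asm) integral_nonneg_eq_0_iff_AE) auto
    then show ?thesis
      by eventually_elim (use G(3) in auto)
  qed
  have S_all: "AE \<omega> in M. \<forall>t\<ge>0. total_power (?X t \<omega>) = \<sigma> t * S"
    by (rule AE_all_times_from_rational_times[OF S_fixed paths])
      (auto simp: \<sigma>_def intro!: continuous_intros)
  then show "AE \<omega> in M. \<forall>z\<ge>0. (cmod (up z \<omega>))\<^sup>2 + (cmod (um z \<omega>))\<^sup>2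
      = 2 * ((cmod ae)\<^sup>2 + (cmod ao)\<^sup>2) * exp (- \<Lambda> * z)"
    unfolding S_eq \<sigma>_def total_power_def by (simp add: mult.commute)

  obtain s s' where s: "\<And>z. (s has_real_derivative s' z) (at z)"
    and s': "\<And>z. (s' has_real_derivative - 2 * \<Gamma> * s' z - \<omega>0\<^sup>2 * s z) (at z)"
    and init: "s 0 = 0" "s' 0 = 1"
    and closed_form: "\<And>z. s' z + 2 * \<Gamma> * s z =
      (if \<omega>0 < \<Gamma> then
         exp (- \<Gamma> * z) * (cosh (sqrt (\<Gamma>\<^sup>2 - \<omega>0\<^sup>2) * z)
           + \<Gamma> / sqrt (\<Gamma>\<^sup>2 - \<omega>0\<^sup>2) * sinh (sqrt (\<Gamma>\<^sup>2 - \<omega>0\<^sup>2) * z))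
       else if \<omega>0 = \<Gamma> then (1 + \<Gamma> * z) * exp (- \<Gamma> * z)
       else
         exp (- \<Gamma> * z) * (cos (sqrt (\<omega>0\<^sup>2 - \<Gamma>\<^sup>2) * z)
           + \<Gamma> / sqrt (\<omega>0\<^sup>2 - \<Gamma>\<^sup>2) * sin (sqrt (\<omega>0\<^sup>2 - \<Gamma>\<^sup>2) * z)))"
    using damped_oscillator_impulse_response[OF \<omega>0 \<Gamma>] by blast
  define a where "a z = s' z + 2 * \<Gamma> * s z" for z
  define b where "b z = \<omega>0 * s z" for z
  have a: "(a has_real_derivative - \<omega>0 * b z) (at z)" for z
    unfolding a_def b_def by (auto intro!: derivative_eq_intros s s' simp: power2_eq_square)
  have b: "(b has_real_derivative \<omega>0 * a z - 2 * \<Gamma> * b z) (at z)" for z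
    unfolding a_def b_def by (auto intro!: derivative_eq_intros s simp: algebra_simps)
  have ab0: "a 0 = 1" "b 0 = 0"
    by (simp_all add: a_def b_def init)
  have EP: "EP z = (a z * power_difference x + b z * power_exchange x) / S" if "z \<ge> 0" for z
  proof -
    \<comment> \<open>Almost surely the total power at \<open>z\<close> sits at the peak, where the cutoff is \<open>1\<close>.\<close>
    obtain G G' G'' where cutoff: "radial_cutoff G G' G'' (\<sigma> z * S + 1)" and peak: "G (\<sigma> z * S) = 1"
      by (rule peaked_cutoff_exists[of "\<sigma> z * S"]) blast
    interpret radial_cutoff G G' G'' "\<sigma> z * S + 1"
      by (rule cutoff)
    have meas: "test c \<alpha> \<beta> \<tau> \<in> borel_measurable borel" for c \<alpha> \<beta> \<tau>
      unfolding test_def[abs_def]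
      by (intro borel_measurable_continuous_onI continuous_on_compose2[OF G_continuous(1)]
          continuous_intros) auto
    have [measurable]: "(\<lambda>\<omega>. test 0 1 0 1 (?X z \<omega>)) \<in> borel_measurable M"
      using measurable_compose[OF X_meas[OF that] meas] .
    have [measurable]: "up z \<in> borel_measurable M" "um z \<in> borel_measurable M"
      using measurable_compose[OF X_meas[OF that] borel_measurable_continuous_onI[OF continuous_on_fst[OF continuous_on_id]]]
        measurable_compose[OF X_meas[OF that] borel_measurable_continuous_onI[OF continuous_on_snd[OF continuous_on_id]]]
      by simp_all
    have "EP z = (LINT \<omega>|M. test 0 1 0 1 (?X z \<omega>) / (\<sigma> z * S))"
      unfolding EP_def
    proof (rule integral_cong_AE)
      show "AE \<omega> in M. power_imbalance up um z \<omega> = test 0 1 0 1 (?X z \<omega>) / (\<sigma> z * S)"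
        using S_fixed[OF that]
      proof eventually_elim
        case (elim \<omega>)
        then show ?case
          by (simp add: test_def peak)
            (simp add: power_imbalance_def power_difference_def total_power_def)
      qed
    qed (auto simp: power_imbalance_def[abs_def])
    also have "\<dots> = (LINT y|P z x. test 0 1 0 1 y) / (\<sigma> z * S)"
      using integral_X[OF that meas] by simp
    also have "(LINT y|P z x. test 0 1 0 1 y) = test 0 (\<sigma> z * a z) (\<sigma> z * b z) (\<sigma> z) x"
      using expectation_test[OF P gen, where a=a and b=b and t=z and c=0 and x=x] a b that
      unfolding ab0 \<sigma>_def \<omega>0_def \<Gamma>_def \<Lambda>_def by blast
    also have "\<dots> = \<sigma> z * (a z * power_difference x + b z * power_exchange x)"
      using peak by (simp add: test_def S_def algebra_simps)
    finally show ?thesis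
      using \<sigma>[of z] by simp
  qed

  show "\<exists>EP' EP''. \<forall>z\<ge>0.
      (EP has_real_derivative EP' z) (at z within {0..}) \<and>
      (EP' has_real_derivative EP'' z) (at z within {0..}) \<and>
      EP'' z + 2 * \<Gamma> * EP' z + \<omega>0\<^sup>2 * EP z = 0"
  proof (intro exI allI impI conjI)
    define m w where "m = power_difference x / S" and "w = power_exchange x / S"
    have EP': "EP z = a z * m + b z * w" if "z \<ge> 0" for z
      using EP[OF that] by (simp add: m_def w_def add_divide_distrib)
    fix z :: real assume "z \<ge> 0"
    show "(EP has_real_derivative (- \<omega>0 * b z * m + (\<omega>0 * a z - 2 * \<Gamma> * b z) * w)) (at z within {0..})"
    proof (rule has_field_derivative_transform_within[of _ _ _ _ 1])
      show "((\<lambda>z. a z * m + b z * w) has_real_derivative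
          (- \<omega>0 * b z * m + (\<omega>0 * a z - 2 * \<Gamma> * b z) * w)) (at z within {0..})"
        by (rule has_field_derivative_at_within) (auto intro!: derivative_eq_intros a b)
    qed (use EP' \<open>z \<ge> 0\<close> in auto)
    show "((\<lambda>z. - \<omega>0 * b z * m + (\<omega>0 * a z - 2 * \<Gamma> * b z) * w) has_real_derivative
        (- \<omega>0 * (\<omega>0 * a z - 2 * \<Gamma> * b z) * m
         + (\<omega>0 * (- \<omega>0 * b z) - 2 * \<Gamma> * (\<omega>0 * a z - 2 * \<Gamma> * b z)) * w)) (at z within {0..})"
      by (rule has_field_derivative_at_within)
        (auto intro!: derivative_eq_intros a b simp: algebra_simps)
    show "(- \<omega>0 * (\<omega>0 * a z - 2 * \<Gamma> * b z) * m
         + (\<omega>0 * (- \<omega>0 * b z) - 2 * \<Gamma> * (\<omega>0 * a z - 2 * \<Gamma> * b z)) * w)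
       + 2 * \<Gamma> * (- \<omega>0 * b z * m + (\<omega>0 * a z - 2 * \<Gamma> * b z) * w) + \<omega>0\<^sup>2 * EP z = 0"
      unfolding EP'[OF \<open>z \<ge> 0\<close>] by (simp add: power2_eq_square algebra_simps)
  qed

  assume "ae = ao"
  then have x: "x = (2 * ae, 0)" and "ae \<noteq> 0"
    using assms(14) by (auto simp: x_def)
  show "AE \<omega> in M. um 0 \<omega> = 0 \<and> power_imbalance up um 0 \<omega> = 1"
    using assms(16)
    by eventually_elim (use \<open>ae = ao\<close> \<open>ae \<noteq> 0\<close> in \<open>simp add: power_imbalance_def\<close>)
  have "power_difference x = S" "power_exchange x = 0"
    by (simp_all add: S_def x form_defs)
  then have "EP z = s' z + 2 * \<Gamma> * s z" if "z \<ge> 0" for z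
    using EP[OF that] \<open>S > 0\<close> by (simp add: a_def)
  from trans[OF this closed_form] show "\<forall>z\<ge>0. EP z =
      (if \<omega>0 < \<Gamma> then
         exp (- \<Gamma> * z) * (cosh (sqrt (\<Gamma>\<^sup>2 - \<omega>0\<^sup>2) * z)
           + \<Gamma> / sqrt (\<Gamma>\<^sup>2 - \<omega>0\<^sup>2) * sinh (sqrt (\<Gamma>\<^sup>2 - \<omega>0\<^sup>2) * z))
       else if \<omega>0 = \<Gamma> then (1 + \<Gamma> * z) * exp (- \<Gamma> * z)
       else
         exp (- \<Gamma> * z) * (cos (sqrt (\<omega>0\<^sup>2 - \<Gamma>\<^sup>2) * z)
           + \<Gamma> / sqrt (\<omega>0\<^sup>2 - \<Gamma>\<^sup>2) * sin (sqrt (\<omega>0\<^sup>2 - \<Gamma>\<^sup>2) * z)))"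
    by (intro allI impI)
qed

end
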